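(* Let $H_1\in(0,1/2]$, $H_2\in(1/2,1)$, $x_0\in\mathbb{R}$, and let $b\colon[0,T]\times\mathbb{R}\to\mathbb{R}$ be measurable and such that: (B1) there exists $c\in(0,\infty)$ with $|b(t,x)|\le c$ for all $(t,x)\in[0,T]\times\mathbb{R}$; (B2) there are points $a_1<\dots<a_m$ and $L>0$ such that, with $I_0=(-\infty,a_1)$, $I_j=(a_j,a_{j+1})$ for $1\le j\le m-1$, $I_m=(a_m,\infty)$, one has $|b(t,x)-b(t,y)|\le L|x-y|$ for all $j=0,\dots,m$, all $t\in[0,T]$ and all $x,y\in I_j$. For $N\in\mathbb{N}$ let $X^N$ be the solution of $$X^N_t=x_0+\int_0^tb(s,X^N_s)\,\mathrm{d}s+\frac1NB^{H_1}_t+B^{H_2}_t,\quad t\in[0,T],$$ where $B^{H_1},B^{H_2}$ are completely correlated fractional Brownian motions. Let $(N_l)_{l\in\mathbb{N}}$ be a subsequence and $(\tilde\Omega,\tilde{\mathcal{A}},\tilde{\mathbb{P}})$ a probability space carrying versions (denoted by the same symbols) of $\big(X^{N_l},\int_0^\cdot b(s,X^{N_l}_s)\,\mathrm{d}s,B^{H_1}/N_l,B^{H_2}\big)$, equal in law to the original ones, satisfying the same equation, and converging almost surely in $C([0,T];\mathbb{R}^4)$ as $l\to\infty$. Let $X$ be the almost sure limit of $X^{N_l}$. Then, for any $\beta\in(0,H_1)$, the sequence $(X^{N_l})_{l\in\mathbb{N}}$ converges towards $X$ with respect to $\|\cdot\|_\beta$, i.e. $\lim_{l\to\infty}\|X^{N_l}-X\|_\beta=0$,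 where $$\|Y\|_\beta:=\sup_{t\in[0,T]}\left(\mathbb{E}[Y_t^2]+\mathbb{E}\left[\left(\int_0^t\frac{|Y_t-Y_s|}{(t-s)^{1+\beta}}\,\mathrm{d}s\right)^2\right]\right).$$
   Context: $T\in(0,\infty)$ is fixed. The stochastic Besov space $W^\beta[0,T]$ is the set of processes $Y=Y_t(\omega)$, $(t,\omega)\in[0,T]\times\Omega$, with $\|Y\|_\beta<\infty$ (the paper calls $\|\cdot\|_\beta$ a norm). Fractional Brownian motion with Hurst parameter $H\in(0,1)$ is the centered Gaussian process with covariance $\frac12(|t|^{2H}+|s|^{2H}-|t-s|^{2H})$; it has the representation $B^H_t=\int_0^tK_H(t,s)\,\mathrm{d}W_s$ with $K_H(t,s)=c_H(t-s)^{H-1/2}F(H-\tfrac12,\tfrac12-H,H+\tfrac12,1-\tfrac ts)$ for $0<s<t$, where $F$ is the Gauss hypergeometric function and $c_H>0$ a normalizing constant. $B^{H_1}$ and $B^{H_2}$ are completely correlated if both are represented in this way with the same Brownian motion $W$. Under (B1), for each $N$ the equation for $X^N$ is known to have a unique strong solution (adapted to the augmented filtration generated by $W$). As in the paper, the versions of $B^{H_1},B^{H_2}$ on $(\tilde\Omega,\tilde{\mathcal{A}},\tilde{\mathbb{P}})$ are written without dependence on $l$. *)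

theory Defs
  imports "HOL-Probability.Probability"
begin

text \<open>A process is a function of type \<open>real \<Rightarrow> 'a \<Rightarrow> real\<close>, time first; only times in \<open>{0..T}\<close> matter.\<close>

text \<open>
  The Gauss hypergeometric function as the analytic continuation of its power series
  from the unit disc to the complex plane cut along \<open>[1, \<infinity>)\<close>. This is needed because the kernel of
  fractional Brownian motion evaluates it at \<open>1 - t / s\<close>, which ranges over the whole negative axis.
\<close>

definition gauss_hypergeo :: "complex \<Rightarrow> complex \<Rightarrow> complex \<Rightarrow> complex \<Rightarrow> complex" where
  "gauss_hypergeo a b c z =
    (THE w. \<exists>f. f holomorphic_on (- {complex_of_real x | x. 1 \<le> x}) \<and>
                (\<forall>u. norm u < 1 \<longrightarrow> f u = eval_fps (fps_hypergeo [a, b] [c] 1) u) \<and> w = f z)"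

definition volterra_kernel :: "real \<Rightarrow> real \<Rightarrow> real \<Rightarrow> real \<Rightarrow> real" where
  "volterra_kernel c H t s =
    c * (t - s) powr (H - 1/2) *
    Re (gauss_hypergeo (of_real (H - 1/2)) (of_real (1/2 - H)) (of_real (H + 1/2)) (of_real (1 - t / s)))"

definition brownian_motion :: "'a measure \<Rightarrow> real \<Rightarrow> (real \<Rightarrow> 'a \<Rightarrow> real) \<Rightarrow> bool" where
  "brownian_motion M T W \<longleftrightarrow>
    (\<forall>t\<in>{0..T}. W t \<in> borel_measurable M) \<and>
    (AE \<omega> in M. W 0 \<omega> = 0) \<and>
    (AE \<omega> in M. continuous_on {0..T} (\<lambda>t. W t \<omega>)) \<and>
    (\<forall>s t. 0 \<le> s \<longrightarrow> s < t \<longrightarrow> t \<le> T \<longrightarrow>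
      distributed M lborel (\<lambda>\<omega>. W t \<omega> - W s \<omega>) (normal_density 0 (sqrt (t - s)))) \<and>
    (\<forall>(p :: nat \<Rightarrow> real) n. 0 \<le> p 0 \<longrightarrow> (\<forall>i<n. p i < p (Suc i)) \<longrightarrow> p n \<le> T \<longrightarrow>
      prob_space.indep_vars M (\<lambda>_. borel) (\<lambda>i \<omega>. W (p (Suc i)) \<omega> - W (p i) \<omega>) {..<n})"

definition augmented_filtration :: "'a measure \<Rightarrow> (real \<Rightarrow> 'a \<Rightarrow> real) \<Rightarrow> real \<Rightarrow> 'a measure" where
  "augmented_filtration M W t =
    sigma (space M) ({W s -` A \<inter> space M | s A. s \<in> {0..t} \<and> A \<in> sets borel} \<union> null_sets M)"

text \<open>Normal laws, with the Dirac measures as the degenerate case.\<close>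

definition gaussian_rv :: "'a measure \<Rightarrow> ('a \<Rightarrow> real) \<Rightarrow> bool" where
  "gaussian_rv M Z \<longleftrightarrow> Z \<in> borel_measurable M \<and>
    (\<exists>\<mu> \<sigma>. 0 \<le> \<sigma> \<and>
      distr M borel Z = (if \<sigma> = 0 then return borel \<mu> else density lborel (normal_density \<mu> \<sigma>)))"

definition gaussian_process :: "'a measure \<Rightarrow> real set \<Rightarrow> (real \<Rightarrow> 'a \<Rightarrow> real) \<Rightarrow> bool" where
  "gaussian_process M S Y \<longleftrightarrow>
    (\<forall>t\<in>S. Y t \<in> borel_measurable M) \<and>
    (\<forall>J a. finite J \<longrightarrow> J \<subseteq> S \<longrightarrow> gaussian_rv M (\<lambda>\<omega>. \<Sum>t\<in>J. a t * Y t \<omega>))"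

definition fractional_brownian_motion ::
    "'a measure \<Rightarrow> real \<Rightarrow> real \<Rightarrow> (real \<Rightarrow> 'a \<Rightarrow> real) \<Rightarrow> bool" where
  "fractional_brownian_motion M T H B \<longleftrightarrow>
    gaussian_process M {0..T} B \<and>
    (\<forall>t\<in>{0..T}. (\<integral>\<omega>. B t \<omega> \<partial>M) = 0) \<and>
    (\<forall>s\<in>{0..T}. \<forall>t\<in>{0..T}. (\<integral>\<omega>. B t \<omega> * B s \<omega> \<partial>M) =
      1/2 * (\<bar>t\<bar> powr (2 * H) + \<bar>s\<bar> powr (2 * H) - \<bar>t - s\<bar> powr (2 * H)))"

text \<open>
  The Wiener integral of a deterministic square integrable function over \<open>(0, t)\<close>. A list entry
  \<open>(c, u, v)\<close> stands for the step function \<open>c * indicator {u<..v}\<close>, whose integral is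
  \<open>c * (W v - W u)\<close>; the general integral is the limit in mean square along step functions
  converging in \<open>L\<^sup>2(0, t)\<close>.
\<close>

definition step_fun :: "(real \<times> real \<times> real) list \<Rightarrow> real \<Rightarrow> real" where
  "step_fun xs s = (\<Sum>(c, u, v)\<leftarrow>xs. c * indicator {u<..v} s)"

definition step_integral :: "(real \<Rightarrow> 'a \<Rightarrow> real) \<Rightarrow> (real \<times> real \<times> real) list \<Rightarrow> 'a \<Rightarrow> real" where
  "step_integral W xs \<omega> = (\<Sum>(c, u, v)\<leftarrow>xs. c * (W v \<omega> - W u \<omega>))"

definition is_wiener_integral ::
    "'a measure \<Rightarrow> (real \<Rightarrow> 'a \<Rightarrow> real) \<Rightarrow> real \<Rightarrow> (real \<Rightarrow> real) \<Rightarrow> ('a \<Rightarrow> real) \<Rightarrow> bool" where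
  "is_wiener_integral M W t f Z \<longleftrightarrow>
    set_borel_measurable lborel {0<..<t} f \<and> Z \<in> borel_measurable M \<and>
    (\<exists>\<phi> :: nat \<Rightarrow> (real \<times> real \<times> real) list.
      (\<forall>k. \<forall>(c, u, v)\<in>set (\<phi> k). 0 \<le> u \<and> u \<le> v \<and> v \<le> t) \<and>
      ((\<lambda>k. \<integral>\<^sup>+s\<in>{0<..<t}. ennreal ((step_fun (\<phi> k) s - f s)\<^sup>2) \<partial>lborel) \<longlonglongrightarrow> 0) \<and>
      ((\<lambda>k. \<integral>\<^sup>+\<omega>. ennreal ((step_integral W (\<phi> k) \<omega> - Z \<omega>)\<^sup>2) \<partial>M) \<longlonglongrightarrow> 0))"

text \<open>
  The normalizing constant \<open>c\<close> is determined by the requirement that \<open>B\<close> has the covariance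
  of fractional Brownian motion.
\<close>

definition volterra_fbm ::
    "'a measure \<Rightarrow> real \<Rightarrow> (real \<Rightarrow> 'a \<Rightarrow> real) \<Rightarrow> real \<Rightarrow> (real \<Rightarrow> 'a \<Rightarrow> real) \<Rightarrow> bool" where
  "volterra_fbm M T W H B \<longleftrightarrow>
    fractional_brownian_motion M T H B \<and>
    (\<exists>c>0. \<forall>t\<in>{0..T}. is_wiener_integral M W t (volterra_kernel c H t) (B t))"

definition completely_correlated_fbms ::
    "'a measure \<Rightarrow> real \<Rightarrow> (real \<Rightarrow> 'a \<Rightarrow> real) \<Rightarrow> real \<Rightarrow> real \<Rightarrow>
     (real \<Rightarrow> 'a \<Rightarrow> real) \<Rightarrow> (real \<Rightarrow> 'a \<Rightarrow> real) \<Rightarrow> bool" where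
  "completely_correlated_fbms M T W H1 H2 B1 B2 \<longleftrightarrow>
    brownian_motion M T W \<and> volterra_fbm M T W H1 B1 \<and> volterra_fbm M T W H2 B2"

definition drift_integral :: "(real \<Rightarrow> real \<Rightarrow> real) \<Rightarrow> (real \<Rightarrow> 'a \<Rightarrow> real) \<Rightarrow> real \<Rightarrow> 'a \<Rightarrow> real" where
  "drift_integral b X t \<omega> = (LINT s:{0..t}|lborel. b s (X s \<omega>))"

definition satisfies_sde ::
    "'a measure \<Rightarrow> real \<Rightarrow> real \<Rightarrow> (real \<Rightarrow> real \<Rightarrow> real) \<Rightarrow> nat \<Rightarrow>
     (real \<Rightarrow> 'a \<Rightarrow> real) \<Rightarrow> (real \<Rightarrow> 'a \<Rightarrow> real) \<Rightarrow> (real \<Rightarrow> 'a \<Rightarrow> real) \<Rightarrow> bool" where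
  "satisfies_sde M T x0 b N B1 B2 X \<longleftrightarrow>
    (AE \<omega> in M. \<forall>t\<in>{0..T}.
      X t \<omega> = x0 + drift_integral b X t \<omega> + 1 / real N * B1 t \<omega> + B2 t \<omega>)"

definition strong_solution ::
    "'a measure \<Rightarrow> real \<Rightarrow> (real \<Rightarrow> 'a \<Rightarrow> real) \<Rightarrow> real \<Rightarrow> (real \<Rightarrow> real \<Rightarrow> real) \<Rightarrow> nat \<Rightarrow>
     (real \<Rightarrow> 'a \<Rightarrow> real) \<Rightarrow> (real \<Rightarrow> 'a \<Rightarrow> real) \<Rightarrow> (real \<Rightarrow> 'a \<Rightarrow> real) \<Rightarrow> bool" where
  "strong_solution M T W x0 b N B1 B2 X \<longleftrightarrow>
    (\<forall>t\<in>{0..T}. X t \<in> borel_measurable (augmented_filtration M W t)) \<and>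
    (\<forall>\<omega>\<in>space M. continuous_on {0..T} (\<lambda>t. X t \<omega>)) \<and>
    satisfies_sde M T x0 b N B1 B2 X"

text \<open>The interval \<open>I_j\<close>, \<open>0 \<le> j \<le> m\<close>, cut out by the points \<open>a 1 < \<dots> < a m\<close>.\<close>

definition piece :: "(nat \<Rightarrow> real) \<Rightarrow> nat \<Rightarrow> nat \<Rightarrow> real set" where
  "piece a m j = (if j = 0 then {..<a 1} else if j = m then {a m<..} else {a j<..<a (Suc j)})"

definition bounded_drift :: "real \<Rightarrow> (real \<Rightarrow> real \<Rightarrow> real) \<Rightarrow> bool" where
  "bounded_drift T b \<longleftrightarrow> (\<exists>c>0. \<forall>t\<in>{0..T}. \<forall>x. \<bar>b t x\<bar> \<le> c)"

definition piecewise_lipschitz_drift :: "real \<Rightarrow> (real \<Rightarrow> real \<Rightarrow> real) \<Rightarrow> bool" where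
  "piecewise_lipschitz_drift T b \<longleftrightarrow>
    (\<exists>(m :: nat) (a :: nat \<Rightarrow> real) L. 1 \<le> m \<and> (\<forall>j\<in>{1..<m}. a j < a (Suc j)) \<and> L > 0 \<and>
      (\<forall>j\<in>{0..m}. \<forall>t\<in>{0..T}. \<forall>x\<in>piece a m j. \<forall>y\<in>piece a m j. \<bar>b t x - b t y\<bar> \<le> L * \<bar>x - y\<bar>))"

text \<open>The space \<open>C([0,T]; \<real>\<^sup>4)\<close> with the uniform metric, and its Borel sigma-algebra.\<close>

type_synonym real4 = "real \<times> real \<times> real \<times> real"

definition path_space :: "real \<Rightarrow> (real \<Rightarrow> real4) metric" where
  "path_space T = cfunspace (top_of_set {0..T}) euclidean_metric"

definition path_borel :: "real \<Rightarrow> (real \<Rightarrow> real4) measure" where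
  "path_borel T = sigma (mspace (path_space T)) {U. openin (mtopology_of (path_space T)) U}"

definition path4 ::
    "real \<Rightarrow> (real \<Rightarrow> 'a \<Rightarrow> real) \<Rightarrow> (real \<Rightarrow> 'a \<Rightarrow> real) \<Rightarrow> (real \<Rightarrow> 'a \<Rightarrow> real) \<Rightarrow> (real \<Rightarrow> 'a \<Rightarrow> real) \<Rightarrow>
     'a \<Rightarrow> real \<Rightarrow> real4" where
  "path4 T Y1 Y2 Y3 Y4 \<omega> = (\<lambda>t\<in>{0..T}. (Y1 t \<omega>, Y2 t \<omega>, Y3 t \<omega>, Y4 t \<omega>))"

definition equal_in_law ::
    "'c measure \<Rightarrow> 'a measure \<Rightarrow> ('a \<Rightarrow> 'c) \<Rightarrow> 'b measure \<Rightarrow> ('b \<Rightarrow> 'c) \<Rightarrow> bool" where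
  "equal_in_law S M Y M' Y' \<longleftrightarrow>
    Y \<in> measurable M S \<and> Y' \<in> measurable M' S \<and> distr M S Y = distr M' S Y'"

text \<open>The stochastic Besov functional, with values in \<open>[0, \<infinity>]\<close>; all integrands are nonnegative.\<close>

definition besov_norm :: "'a measure \<Rightarrow> real \<Rightarrow> real \<Rightarrow> (real \<Rightarrow> 'a \<Rightarrow> real) \<Rightarrow> ennreal" where
  "besov_norm M T \<beta> Y =
    (SUP t\<in>{0..T}.
      (\<integral>\<^sup>+\<omega>. ennreal ((Y t \<omega>)\<^sup>2) \<partial>M) +
      (\<integral>\<^sup>+\<omega>. (\<integral>\<^sup>+s\<in>{0..<t}. ennreal (\<bar>Y t \<omega> - Y s \<omega>\<bar> / (t - s) powr (1 + \<beta>)) \<partial>lborel)\<^sup>2 \<partial>M))"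

end

theory Submission
  imports Defs
begin

text \<open>
  The solutions are Hoelder continuous of order \<open>H1\<close> in mean square and bounded in fourth moment,
  uniformly in \<open>N\<close>: the drift is pathwise Lipschitz, and the noise is Gaussian with explicit covariance.
  Both bounds only involve laws of one or two coordinates, so they pass to the versions and, by Fatou,
  to the limit \<open>X\<close>. The fourth moments make almost sure uniform convergence imply
  \<open>sup\<^sub>t E (X' l t - X t)\<^sup>2 \<longrightarrow> 0\<close>. In the increment term, Cauchy--Schwarz and interpolation of
  \<open>E ((X' l - X) t - (X' l - X) s)\<^sup>2\<close> between this supremum and \<open>\<bar>t - s\<bar> powr (2 * H1)\<close> leave an integrable
  singularity, because \<open>\<beta> < H1\<close>.
\<close>

text \<open>Write D for \<open>X' l - X\<close>. Neither bound on E ((D t - D s)^2) suffices alone: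
  the Hoelder bound makes the increment term finite but not small, while the uniform bound tends to
  0 but leaves a singularity in t - s that is not integrable. A weighted geometric mean of the two
  keeps a positive power of the small factor and enough of |t - s| to integrate. Moments are
  computed on \<open>M\<close>, where the noise is given with its covariance, and reach
  \<open>M'\<close> only through the path law. No equation for the limit \<open>X\<close> is at
  hand, so its bounds are inherited from those of \<open>X' l\<close>; this requires constants that
  do not depend on l. The functional takes its supremum over t outside the expectation. Mean square
  convergence at each fixed t would not control it, so convergence is proved along times that vary
  with l; this is where uniform convergence of the paths enters.\<close>

section \<open>Moments of Gaussian variables and of fractional Brownian motion\<close>

text \<open>The covariance of fractional Brownian motion is given by Bochner integrals, which are 0
  for functions that are not integrable. Integrability is what allows these identities to be read as
  statements about nonnegative integrals.\<close>

lemma gaussian_rv_integrable_power: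
  assumes "prob_space M" and Z: "gaussian_rv M Z"
  shows "integrable M (\<lambda>\<omega>. Z \<omega> ^ k)"
proof -
  interpret prob_space M by fact
  have [measurable]: "Z \<in> borel_measurable M" using Z by (simp add: gaussian_rv_def)
  obtain \<mu> \<sigma> where \<sigma>: "0 \<le> \<sigma>"
    and d: "distr M borel Z = (if \<sigma> = 0 then return borel \<mu> else density lborel (normal_density \<mu> \<sigma>))"
    using Z unfolding gaussian_rv_def by blast
  have "integrable (distr M borel Z) (\<lambda>x. x ^ k)"
  proof (cases "\<sigma> = 0")
    case True
    then show ?thesis
      unfolding d using prob_space_return[of \<mu> borel]
      by (auto intro!: integrableI_bounded simp: nn_integral_return ennreal_less_top)
  next
    case False
    then have s: "\<sigma> > 0" using \<sigma> by simp
    have "integrable lborel (\<lambda>x. normal_density \<mu> \<sigma> x * x ^ k)"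
    proof -
      \<comment> \<open>Expanding around the mean reduces raw moments to central ones.\<close>
      have "x ^ k = (\<Sum>j\<le>k. real (k choose j) * (x - \<mu>) ^ j * \<mu> ^ (k - j))" for x
        using binomial_ring[of "x - \<mu>" \<mu> k] by simp
      then have "(\<lambda>x. normal_density \<mu> \<sigma> x * x ^ k) =
          (\<lambda>x. \<Sum>j\<le>k. real (k choose j) * \<mu> ^ (k - j) * (normal_density \<mu> \<sigma> x * (x - \<mu>) ^ j))"
        by (auto simp: fun_eq_iff sum_distrib_left intro!: sum.cong)
      then show ?thesis
        using integrable_normal_moment[OF s] by (auto intro!: Bochner_Integration.integrable_sum)
    qed
    then show ?thesis
      unfolding d using False by (simp add: integrable_density normal_density_nonneg)
  qed
  then show ?thesis by (subst (asm) integrable_distr_eq) auto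
qed

text \<open>A centered normal law with variance v has fourth moment 3 * v^2. Fourth moments are
  thereby controlled by the covariance alone.\<close>

lemma gaussian_rv_centered_fourth_moment:
  assumes "prob_space M" and Z: "gaussian_rv M Z" and z: "(\<integral>\<omega>. Z \<omega> \<partial>M) = 0"
  shows "(\<integral>\<omega>. Z \<omega> ^ 4 \<partial>M) \<le> 3 * (\<integral>\<omega>. (Z \<omega>)\<^sup>2 \<partial>M)\<^sup>2"
proof -
  interpret prob_space M by fact
  have [measurable]: "Z \<in> borel_measurable M" using Z by (simp add: gaussian_rv_def)
  obtain \<mu> \<sigma> where \<sigma>: "0 \<le> \<sigma>"
    and d: "distr M borel Z = (if \<sigma> = 0 then return borel \<mu> else density lborel (normal_density \<mu> \<sigma>))"
    using Z unfolding gaussian_rv_def by blast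
  have E: "(\<integral>\<omega>. Z \<omega> ^ k \<partial>M) = (\<integral>x. x ^ k \<partial>distr M borel Z)" for k
    by (subst integral_distr) auto
  show ?thesis
  proof (cases "\<sigma> = 0")
    \<comment> \<open>A Dirac law with mean 0 sits at 0, so both sides vanish.\<close>
    case True
    then have "(\<integral>\<omega>. Z \<omega> ^ k \<partial>M) = \<mu> ^ k" for k
      unfolding E d by (simp add: integral_return)
    from this[of 1] this[of 2] this[of 4] z show ?thesis by simp
  next
    case False
    then have s: "\<sigma> > 0" using \<sigma> by simp
    have E': "(\<integral>\<omega>. Z \<omega> ^ k \<partial>M) = (\<integral>x. normal_density \<mu> \<sigma> x * x ^ k \<partial>lborel)" for k
      unfolding E d using False by (simp add: integral_density normal_density_nonneg)
    have "\<mu> = 0" using E'[of 1] z integral_normal_moment_nz_1[OF s, of \<mu>] by simp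
    then have "(\<integral>\<omega>. Z \<omega> ^ (2*k) \<partial>M) = fact (2 * k) / ((2 / \<sigma>\<^sup>2)^k * fact k)" for k
      unfolding E' using integral_normal_moment_even[OF s, of \<mu> k] by simp
    from this[of 1] this[of 2] s show ?thesis
      by (simp add: fact_numeral field_simps power2_eq_square power4_eq_xxxx)
  qed
qed

lemma fractional_brownian_motion_increment:
  assumes "prob_space M" and B: "fractional_brownian_motion M T H B" and "0 < H"
    and st: "s \<in> {0..T}" "t \<in> {0..T}"
  shows "(\<integral>\<^sup>+\<omega>. ennreal ((B t \<omega> - B s \<omega>)\<^sup>2) \<partial>M) = ennreal (\<bar>t - s\<bar> powr (2 * H))"
proof -
  interpret prob_space M by fact
  have G: "gaussian_rv M (B r)" if "r \<in> {0..T}" for r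
    using B that unfolding fractional_brownian_motion_def gaussian_process_def
    by (auto dest!: spec[of _ "{r}"] spec[of _ "\<lambda>_. 1"])
  have [measurable]: "B s \<in> borel_measurable M" "B t \<in> borel_measurable M"
    using st B unfolding fractional_brownian_motion_def gaussian_process_def by auto
  have i2: "integrable M (\<lambda>\<omega>. (B r \<omega>)\<^sup>2)" if "r \<in> {0..T}" for r
    using gaussian_rv_integrable_power[OF assms(1) G[OF that]] .
  have i1: "integrable M (\<lambda>\<omega>. B t \<omega> * B s \<omega>)"
  proof (rule Bochner_Integration.integrable_bound)
    show "integrable M (\<lambda>\<omega>. (B t \<omega>)\<^sup>2 + (B s \<omega>)\<^sup>2)" using i2 st by auto
    have "\<bar>x * y\<bar> \<le> x\<^sup>2 + y\<^sup>2" for x y :: real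
      using zero_le_power2[of "\<bar>x\<bar> - \<bar>y\<bar>"] mult_nonneg_nonneg[of "\<bar>x\<bar>" "\<bar>y\<bar>"]
      unfolding power2_diff power2_abs abs_mult by linarith
    then show "AE \<omega> in M. norm (B t \<omega> * B s \<omega>) \<le> norm ((B t \<omega>)\<^sup>2 + (B s \<omega>)\<^sup>2)" by simp
  qed simp
  have C: "(\<integral>\<omega>. B t \<omega> * B s \<omega> \<partial>M) = 1/2 * (\<bar>t\<bar> powr (2 * H) + \<bar>s\<bar> powr (2 * H) - \<bar>t - s\<bar> powr (2 * H))"
    if "s \<in> {0..T}" "t \<in> {0..T}" for s t
    using B that unfolding fractional_brownian_motion_def by blast
  have e: "(\<lambda>\<omega>. (B t \<omega> - B s \<omega>)\<^sup>2) = (\<lambda>\<omega>. (B t \<omega>)\<^sup>2 + (B s \<omega>)\<^sup>2 - 2 * (B t \<omega> * B s \<omega>))"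
    by (auto simp: power2_eq_square algebra_simps)
  have i: "integrable M (\<lambda>\<omega>. (B t \<omega> - B s \<omega>)\<^sup>2)"
    unfolding e using i1 i2 st by auto
  have "(\<integral>\<omega>. (B t \<omega> - B s \<omega>)\<^sup>2 \<partial>M) = \<bar>t - s\<bar> powr (2 * H)"
    unfolding e using i1 i2 st C[OF st] C[OF st(1) st(1)] C[OF st(2) st(2)] \<open>0 < H\<close>
    by (simp add: power2_eq_square[symmetric])
  then show ?thesis using i by (simp add: nn_integral_eq_integral)
qed

lemma fractional_brownian_motion_fourth_moment:
  assumes "prob_space M" and B: "fractional_brownian_motion M T H B" and "0 < H" and t: "t \<in> {0..T}"
  shows "(\<integral>\<^sup>+\<omega>. ennreal (B t \<omega> ^ 4) \<partial>M) \<le> ennreal (3 * T powr (4 * H))"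
proof -
  have G: "gaussian_rv M (B t)"
    using B t unfolding fractional_brownian_motion_def gaussian_process_def
    by (auto dest!: spec[of _ "{t}"] spec[of _ "\<lambda>_. 1"])
  have "(\<integral>\<omega>. B t \<omega> ^ 4 \<partial>M) \<le> 3 * (\<integral>\<omega>. (B t \<omega>)\<^sup>2 \<partial>M)\<^sup>2"
    using gaussian_rv_centered_fourth_moment[OF assms(1) G] B t
    unfolding fractional_brownian_motion_def by blast
  also have "(\<integral>\<omega>. (B t \<omega>)\<^sup>2 \<partial>M) = t powr (2 * H)"
  proof -
    have "(\<integral>\<omega>. B t \<omega> * B t \<omega> \<partial>M) = 1/2 * (\<bar>t\<bar> powr (2 * H) + \<bar>t\<bar> powr (2 * H) - \<bar>t - t\<bar> powr (2 * H))"
      using B t unfolding fractional_brownian_motion_def by blast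
    then show ?thesis using t \<open>0 < H\<close> by (simp add: power2_eq_square)
  qed
  also have "(t powr (2 * H))\<^sup>2 = t powr (4 * H)"
    by (simp add: power2_eq_square powr_add[symmetric])
  also have "\<dots> \<le> T powr (4 * H)" using t \<open>0 < H\<close> by (intro powr_mono2) auto
  finally have "(\<integral>\<omega>. B t \<omega> ^ 4 \<partial>M) \<le> 3 * T powr (4 * H)" by simp
  then show ?thesis
    using gaussian_rv_integrable_power[OF assms(1) G, of 4]
    by (simp add: nn_integral_eq_integral)
qed

section \<open>Moment bounds for solutions, uniform in the noise factor 1/n\<close>

lemma drift_integral_lipschitz:
  assumes b: "(\<lambda>(t, x). b t x) \<in> borel_measurable (restrict_space borel ({0..T} \<times> (UNIV :: real set)))"
    and c: "\<And>t x. t \<in> {0..T} \<Longrightarrow> \<bar>b t x\<bar> \<le> c"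
    and X: "continuous_on {0..T} (\<lambda>t. X t \<omega>)"
    and st: "s \<in> {0..T}" "t \<in> {0..T}"
  shows "\<bar>drift_integral b X t \<omega> - drift_integral b X s \<omega>\<bar> \<le> c * \<bar>t - s\<bar>"
proof -
  let ?f = "\<lambda>r. b r (X r \<omega>)"
  \<comment> \<open>Continuity of the path makes the integrand measurable. Since \<open>b\<close> is
    measurable only on the strip, the map into the plane has to be restricted to that strip before
    composing.\<close>
  have "(\<lambda>r. (r, X r \<omega>)) \<in> measurable (restrict_space borel {0..T}) (borel \<Otimes>\<^sub>M borel)"
    using borel_measurable_continuous_on_restrict[OF X]
    by (intro measurable_Pair) (auto intro: measurable_restrict_space1)
  then have "(\<lambda>r. (r, X r \<omega>)) \<in>
      measurable (restrict_space borel {0..T}) (restrict_space borel ({0..T} \<times> UNIV))"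
    by (intro measurable_restrict_space2) (auto simp: space_restrict_space borel_prod)
  from measurable_compose[OF this b]
  have "?f \<in> borel_measurable (restrict_space borel {0..T})" by simp
  then have meas [measurable]: "(\<lambda>r. indicator {0..T} r * ?f r) \<in> borel_measurable borel"
    by (subst (asm) borel_measurable_restrict_space_iff) (auto simp: mult.commute)
  have int: "set_integrable lborel {0..T} ?f"
    unfolding set_integrable_def
  proof (rule Bochner_Integration.integrable_bound)
    show "integrable lborel (\<lambda>r. c * indicator {0..T} r)"
      by (intro integrable_mult_right) (simp add: integrable_indicator_iff emeasure_lborel_Icc_eq)
    show "AE r in lborel. norm (indicator {0..T} r *\<^sub>R ?f r) \<le> norm (c * indicator {0..T} r)"
      using c order_trans[OF abs_ge_zero c] by (auto simp: indicator_def)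
  qed (use meas in simp)
  have *: "\<bar>drift_integral b X v \<omega> - drift_integral b X u \<omega>\<bar> \<le> c * (v - u)"
    if uv: "0 \<le> u" "u \<le> v" "v \<le> T" for u v
  proof -
    have c0: "0 \<le> c" using order_trans[OF abs_ge_zero c[of u]] uv by auto
    have "{0..v} = {0..u} \<union> {u<..v}" using uv by auto
    then have "drift_integral b X v \<omega> = drift_integral b X u \<omega> + (LINT r:{u<..v}|lborel. ?f r)"
      unfolding drift_integral_def
      using set_integral_Un[of "{0..u}" "{u<..v}" lborel ?f]
        set_integrable_subset[OF int, of "{0..u}"] set_integrable_subset[OF int, of "{u<..v}"] uv
      by (force simp: subset_eq)
    moreover have "\<bar>LINT r:{u<..v}|lborel. ?f r\<bar> \<le> (LINT r:{u<..v}|lborel. c)"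
    proof -
      have i: "set_integrable lborel {u<..v} ?f"
        by (rule set_integrable_subset[OF int]) (use uv in auto)
      have "\<bar>LINT r:{u<..v}|lborel. ?f r\<bar> \<le> (LINT r:{u<..v}|lborel. \<bar>?f r\<bar>)"
        using set_integral_norm_bound[OF i] by simp
      also have "\<dots> \<le> (LINT r:{u<..v}|lborel. c)"
        using i c uv by (intro set_integral_mono set_integrable_abs) (auto simp: set_integrable_def)
      finally show ?thesis .
    qed
    moreover have "(LINT r:{u<..v}|lborel. c) = c * (v - u)"
      using uv by (simp add: set_lebesgue_integral_def)
    ultimately show ?thesis by simp
  qed
  show ?thesis
  proof (cases "s \<le> t")
    case True
    then show ?thesis using *[of s t] st by simp
  next
    case False
    then show ?thesis using *[of t s] st by (simp add: abs_minus_commute)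
  qed
qed

lemma square_sum3_le: "(x + y + z)\<^sup>2 \<le> 3 * (x\<^sup>2 + y\<^sup>2 + z\<^sup>2)" for x y z :: real
proof -
  have "3 * (x\<^sup>2 + y\<^sup>2 + z\<^sup>2) - (x + y + z)\<^sup>2 = (x - y)\<^sup>2 + (y - z)\<^sup>2 + (z - x)\<^sup>2"
    by (simp add: power2_eq_square algebra_simps)
  then show ?thesis by (smt (verit) zero_le_power2)
qed

lemma square_add_le: "(x + y)\<^sup>2 \<le> 2 * (x\<^sup>2 + y\<^sup>2)" for x y :: real
proof -
  have "2 * (x\<^sup>2 + y\<^sup>2) - (x + y)\<^sup>2 = (x - y)\<^sup>2" by (simp add: power2_eq_square algebra_simps)
  then show ?thesis by (smt (verit) zero_le_power2)
qed

lemma power4_add_le: "(x + y) ^ 4 \<le> 8 * (x ^ 4 + y ^ 4)" for x y :: real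
proof -
  have "(x + y) ^ 4 = ((x + y)\<^sup>2)\<^sup>2" by simp
  also have "\<dots> \<le> (2 * (x\<^sup>2 + y\<^sup>2))\<^sup>2" by (rule power_mono[OF square_add_le]) simp
  also have "\<dots> = 4 * (x\<^sup>2 + y\<^sup>2)\<^sup>2" by (simp only: power_mult_distrib) simp
  also have "\<dots> \<le> 4 * (2 * ((x\<^sup>2)\<^sup>2 + (y\<^sup>2)\<^sup>2))" using square_add_le[of "x\<^sup>2" "y\<^sup>2"] by simp
  finally show ?thesis by simp
qed

text \<open>On a bounded time interval the lowest exponent dominates up to a constant. This puts the
  squared increments of the drift (exponent 2) and of \<open>B2\<close> (exponent 2 * H2) under the
  exponent 2 * H1 of \<open>B1\<close>.\<close>

lemma powr_le_powr_smaller_exponent: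
  fixes d T p q :: real
  assumes "0 \<le> d" "d \<le> T" "p \<le> q"
  shows "d powr q \<le> T powr (q - p) * d powr p"
proof -
  have "d powr q = d powr (q - p) * d powr p" by (simp add: powr_add[symmetric])
  also have "\<dots> \<le> T powr (q - p) * d powr p" using assms by (intro mult_right_mono powr_mono2) auto
  finally show ?thesis .
qed

lemma ennreal_numeral_mult_sum3:
  assumes "0 \<le> x" "0 \<le> y" "0 \<le> z"
  shows "numeral k * (ennreal x + ennreal y + ennreal z) = ennreal (numeral k * (x + y + z))"
  using assms by (simp add: ennreal_mult)

lemma ennreal_numeral_mult_sum2:
  assumes "0 \<le> x" "0 \<le> y"
  shows "numeral k * (ennreal x + ennreal y) = ennreal (numeral k * (x + y))"
  using assms by (simp add: ennreal_mult)

text \<open>Splitting the power of the sum into powers of the summands lets each noise be estimated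
  by its own moments. The factor 3 in the first bound is the price of a square of three
  summands.\<close>

lemma satisfies_sde_moments:
  assumes "prob_space M" and T: "0 < T" and H1: "0 < H1" "H1 \<le> H2" "H2 \<le> 1"
    and B1: "fractional_brownian_motion M T H1 B1" and B2: "fractional_brownian_motion M T H2 B2"
    and b: "(\<lambda>(t, x). b t x) \<in> borel_measurable (restrict_space borel ({0..T} \<times> (UNIV :: real set)))"
    and c: "\<And>t x. t \<in> {0..T} \<Longrightarrow> \<bar>b t x\<bar> \<le> c"
    and X: "\<And>\<omega>. \<omega> \<in> space M \<Longrightarrow> continuous_on {0..T} (\<lambda>t. X t \<omega>)"
    and sde: "satisfies_sde M T x0 b n B1 B2 X" and n: "1 \<le> n"
  shows "s \<in> {0..T} \<Longrightarrow> t \<in> {0..T} \<Longrightarrow> (\<integral>\<^sup>+\<omega>. ennreal ((X t \<omega> - X s \<omega>)\<^sup>2) \<partial>M)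
      \<le> ennreal (3 * (c\<^sup>2 * T powr (2 - 2 * H1) + 1 + T powr (2 * H2 - 2 * H1)) * \<bar>t - s\<bar> powr (2 * H1))"
    and "t \<in> {0..T} \<Longrightarrow> (\<integral>\<^sup>+\<omega>. ennreal (X t \<omega> ^ 4) \<partial>M)
      \<le> ennreal (64 * (x0 ^ 4 + (c * T) ^ 4 + 3 * T powr (4 * H1) + 3 * T powr (4 * H2)))"
proof -
  interpret prob_space M by fact
  have lip: "AE \<omega> in M. \<forall>u\<in>{0..T}. \<forall>v\<in>{0..T}.
      \<bar>drift_integral b X v \<omega> - drift_integral b X u \<omega>\<bar> \<le> c * \<bar>v - u\<bar>"
    using X by (intro AE_I2 ballI drift_integral_lipschitz[OF b c]) auto
  have Bm: "B1 r \<in> borel_measurable M" "B2 r \<in> borel_measurable M" if "r \<in> {0..T}" for r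
    using B1 B2 that by (auto simp: fractional_brownian_motion_def gaussian_process_def)
  \<comment> \<open>Independence of n comes from here: the factor 1/n is replaced by 1.\<close>
  have inv_n: "(x / real n)\<^sup>2 \<le> x\<^sup>2" "(x / real n) ^ 4 \<le> x ^ 4" for x :: real
  proof -
    have "\<bar>x / real n\<bar> \<le> \<bar>x\<bar>" using n by (simp add: divide_le_eq mult_le_cancel_left1)
    from power_mono[OF this, of 2] power_mono[OF this, of 4]
    show "(x / real n)\<^sup>2 \<le> x\<^sup>2" "(x / real n) ^ 4 \<le> x ^ 4" by (simp_all add: power_divide power_even_abs)
  qed
  {
    assume st: "s \<in> {0..T}" "t \<in> {0..T}"
    note [measurable] = Bm[OF st(1)] Bm[OF st(2)]
    let ?d = "\<bar>t - s\<bar>"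
    have d: "?d \<le> T" using st by auto
    have "AE \<omega> in M. (X t \<omega> - X s \<omega>)\<^sup>2 \<le>
        3 * (c\<^sup>2 * ?d\<^sup>2 + (B1 t \<omega> - B1 s \<omega>)\<^sup>2 + (B2 t \<omega> - B2 s \<omega>)\<^sup>2)"
      using sde[unfolded satisfies_sde_def] lip
    proof eventually_elim
      case (elim \<omega>)
      let ?D = "drift_integral b X t \<omega> - drift_integral b X s \<omega>"
      have "\<bar>?D\<bar> \<le> c * ?d" using elim(2) st by blast
      from power_mono[OF this, of 2] have D: "?D\<^sup>2 \<le> c\<^sup>2 * ?d\<^sup>2"
        by (simp add: power_mult_distrib)
      have "X t \<omega> - X s \<omega> = ?D + (B1 t \<omega> - B1 s \<omega>) / real n + (B2 t \<omega> - B2 s \<omega>)"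
        using elim(1) st by (simp add: diff_divide_distrib)
      then have "(X t \<omega> - X s \<omega>)\<^sup>2 \<le> 3 * (?D\<^sup>2 + ((B1 t \<omega> - B1 s \<omega>) / real n)\<^sup>2 + (B2 t \<omega> - B2 s \<omega>)\<^sup>2)"
        using square_sum3_le by metis
      also have "\<dots> \<le> 3 * (c\<^sup>2 * ?d\<^sup>2 + (B1 t \<omega> - B1 s \<omega>)\<^sup>2 + (B2 t \<omega> - B2 s \<omega>)\<^sup>2)"
        using D inv_n(1)[of "B1 t \<omega> - B1 s \<omega>"] by simp
      finally show ?case .
    qed
    then have "(\<integral>\<^sup>+\<omega>. ennreal ((X t \<omega> - X s \<omega>)\<^sup>2) \<partial>M) \<le>
        (\<integral>\<^sup>+\<omega>. 3 * (ennreal (c\<^sup>2 * ?d\<^sup>2) + ennreal ((B1 t \<omega> - B1 s \<omega>)\<^sup>2) + ennreal ((B2 t \<omega> - B2 s \<omega>)\<^sup>2)) \<partial>M)"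
      by (intro nn_integral_mono_AE)
        (auto simp flip: ennreal_plus ennreal_numeral ennreal_mult intro!: ennreal_leI elim!: eventually_mono)
    also have "\<dots> = 3 * (ennreal (c\<^sup>2 * ?d\<^sup>2) + ennreal (?d powr (2 * H1)) + ennreal (?d powr (2 * H2)))"
      using fractional_brownian_motion_increment[OF assms(1) B1 _ st]
        fractional_brownian_motion_increment[OF assms(1) B2 _ st] H1
      by (simp add: nn_integral_cmult nn_integral_add emeasure_space_1)
    also have "\<dots> = ennreal (3 * (c\<^sup>2 * ?d\<^sup>2 + ?d powr (2 * H1) + ?d powr (2 * H2)))"
      by (rule ennreal_numeral_mult_sum3) auto
    also have "\<dots> \<le> ennreal (3 * (c\<^sup>2 * (T powr (2 - 2 * H1) * ?d powr (2 * H1)) + ?d powr (2 * H1)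
        + T powr (2 * H2 - 2 * H1) * ?d powr (2 * H1)))"
    proof -
      have "?d\<^sup>2 = ?d powr 2" by (cases "?d = 0") auto
      also have "\<dots> \<le> T powr (2 - 2 * H1) * ?d powr (2 * H1)"
        using d H1 by (intro powr_le_powr_smaller_exponent) auto
      finally have 1: "c\<^sup>2 * ?d\<^sup>2 \<le> c\<^sup>2 * (T powr (2 - 2 * H1) * ?d powr (2 * H1))"
        by (rule mult_left_mono) simp
      have 2: "?d powr (2 * H2) \<le> T powr (2 * H2 - 2 * H1) * ?d powr (2 * H1)"
        using d H1 by (intro powr_le_powr_smaller_exponent) auto
      show ?thesis using 1 2 by (intro ennreal_leI) simp
    qed
    finally show "(\<integral>\<^sup>+\<omega>. ennreal ((X t \<omega> - X s \<omega>)\<^sup>2) \<partial>M)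
      \<le> ennreal (3 * (c\<^sup>2 * T powr (2 - 2 * H1) + 1 + T powr (2 * H2 - 2 * H1)) * \<bar>t - s\<bar> powr (2 * H1))"
      by (simp add: algebra_simps)
  }
  {
    assume t: "t \<in> {0..T}"
    note [measurable] = Bm[OF t]
    have c0: "0 \<le> c" using order_trans[OF abs_ge_zero c[OF t]] .
    have "AE \<omega> in M. X t \<omega> ^ 4 \<le> 64 * (x0 ^ 4 + (c * T) ^ 4 + B1 t \<omega> ^ 4 + B2 t \<omega> ^ 4)"
      using sde[unfolded satisfies_sde_def] lip
    proof eventually_elim
      case (elim \<omega>)
      let ?D = "drift_integral b X t \<omega>"
      \<comment> \<open>The set \<open>{0..0}\<close> is null but not empty. With this value, the
        Lipschitz bound from time 0 gives the size of the drift.\<close>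
      have "drift_integral b X 0 \<omega> = 0"
      proof -
        have "AE r in lborel. indicator {0..0} r *\<^sub>R b r (X r \<omega>) = 0"
          using AE_lborel_singleton[of 0] by eventually_elim (auto simp: indicator_def)
        then show ?thesis
          unfolding drift_integral_def set_lebesgue_integral_def by (rule integral_eq_zero_AE)
      qed
      then have "\<bar>?D\<bar> \<le> c * t" using elim(2)[rule_format, of 0 t] t T by simp
      also have "\<dots> \<le> c * T" using t c0 by (intro mult_left_mono) auto
      finally have D: "?D ^ 4 \<le> (c * T) ^ 4" using power_mono[of "\<bar>?D\<bar>" "c * T" 4] by (simp add: power_even_abs)
      \<comment> \<open>Grouping the four summands in pairs applies \<open>power4_add_le\<close> at
        two levels, hence 8 * 8 = 64.\<close>
      have "X t \<omega> = (x0 + ?D) + (B1 t \<omega> / real n + B2 t \<omega>)" using elim(1) t by simp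
      then have "X t \<omega> ^ 4 \<le> 8 * ((x0 + ?D) ^ 4 + (B1 t \<omega> / real n + B2 t \<omega>) ^ 4)"
        using power4_add_le by metis
      also have "\<dots> \<le> 8 * (8 * (x0 ^ 4 + ?D ^ 4) + 8 * ((B1 t \<omega> / real n) ^ 4 + B2 t \<omega> ^ 4))"
        by (intro mult_left_mono add_mono power4_add_le) simp
      also have "\<dots> \<le> 64 * (x0 ^ 4 + (c * T) ^ 4 + B1 t \<omega> ^ 4 + B2 t \<omega> ^ 4)"
      proof -
        have "8 * (8 * (x0 ^ 4 + ?D ^ 4) + 8 * ((B1 t \<omega> / real n) ^ 4 + B2 t \<omega> ^ 4))
            = 64 * (x0 ^ 4 + ?D ^ 4 + (B1 t \<omega> / real n) ^ 4 + B2 t \<omega> ^ 4)" by simp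
        also have "\<dots> \<le> 64 * (x0 ^ 4 + (c * T) ^ 4 + B1 t \<omega> ^ 4 + B2 t \<omega> ^ 4)"
          by (intro mult_left_mono add_mono D inv_n order_refl) simp
        finally show ?thesis .
      qed
      finally show ?case .
    qed
    then have "(\<integral>\<^sup>+\<omega>. ennreal (X t \<omega> ^ 4) \<partial>M) \<le>
        (\<integral>\<^sup>+\<omega>. 64 * (ennreal (x0 ^ 4 + (c * T) ^ 4) + ennreal (B1 t \<omega> ^ 4) + ennreal (B2 t \<omega> ^ 4)) \<partial>M)"
      by (intro nn_integral_mono_AE)
        (auto simp flip: ennreal_plus ennreal_numeral ennreal_mult intro!: ennreal_leI elim!: eventually_mono)
    also have "\<dots> = 64 * (ennreal (x0 ^ 4 + (c * T) ^ 4) + (\<integral>\<^sup>+\<omega>. ennreal (B1 t \<omega> ^ 4) \<partial>M)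
        + (\<integral>\<^sup>+\<omega>. ennreal (B2 t \<omega> ^ 4) \<partial>M))"
      by (simp add: nn_integral_cmult nn_integral_add emeasure_space_1)
    also have "\<dots> \<le> 64 * (ennreal (x0 ^ 4 + (c * T) ^ 4) + ennreal (3 * T powr (4 * H1))
        + ennreal (3 * T powr (4 * H2)))"
      using fractional_brownian_motion_fourth_moment[OF assms(1) B1 _ t]
        fractional_brownian_motion_fourth_moment[OF assms(1) B2 _ t] H1
      by (intro mult_left_mono add_mono) auto
    also have "\<dots> = ennreal (64 * (x0 ^ 4 + (c * T) ^ 4 + 3 * T powr (4 * H1) + 3 * T powr (4 * H2)))"
      by (rule ennreal_numeral_mult_sum3) auto
    finally show "(\<integral>\<^sup>+\<omega>. ennreal (X t \<omega> ^ 4) \<partial>M)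
      \<le> ennreal (64 * (x0 ^ 4 + (c * T) ^ 4 + 3 * T powr (4 * H1) + 3 * T powr (4 * H2)))" .
  }
qed

section \<open>Path space: evaluation, transfer of laws, uniform convergence\<close>

text \<open>Evaluation at a time is 1-Lipschitz for the uniform metric.\<close>

lemma path_space_eval_continuous:
  assumes t: "t \<in> {0..T}"
  shows "continuous_map (mtopology_of (path_space T)) euclidean (\<lambda>p. p t)"
proof -
  have "Lipschitz_continuous_map (path_space T) euclidean_metric (\<lambda>p. p t)"
    unfolding Lipschitz_continuous_map_def
  proof (intro conjI exI[of _ 1] ballI)
    fix p q assume "p \<in> mspace (path_space T)" "q \<in> mspace (path_space T)"
    from mdist_cfunspace_imp_mdist_le[OF this[unfolded path_space_def] order_refl, of t]
    show "mdist euclidean_metric (p t) (q t) \<le> 1 * mdist (path_space T) p q"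
      using t by (simp add: path_space_def)
  qed auto
  from Lipschitz_continuous_imp_continuous_map[OF this] show ?thesis by simp
qed

lemma space_path_borel: "space (path_borel T) = mspace (path_space T)"
  unfolding path_borel_def
  by (rule space_measure_of) (use openin_subset in fastforce)

lemma path_eval_measurable:
  assumes t: "t \<in> {0..T}"
  shows "(\<lambda>p. p t) \<in> borel_measurable (path_borel T)"
proof (rule borel_measurableI)
  fix S :: "real4 set" assume "open S"
  then have "openin (mtopology_of (path_space T)) {p \<in> mspace (path_space T). p t \<in> S}"
    using path_space_eval_continuous[OF t] by (auto simp: continuous_map_def)
  moreover have "(\<lambda>p. p t) -` S \<inter> space (path_borel T) = {p \<in> mspace (path_space T). p t \<in> S}"
    by (auto simp: space_path_borel)
  ultimately show "(\<lambda>p. p t) -` S \<inter> space (path_borel T) \<in> sets (path_borel T)"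
    unfolding path_borel_def using openin_subset[of "mtopology_of (path_space T)"]
    by (subst sets_measure_of) auto
qed

text \<open>Measurability into \<open>path_borel T\<close> includes that the values lie in the path
  space, so continuity holds for every point of \<open>space M\<close>, without an exceptional null
  set.\<close>

lemma path4_measurable_continuous:
  assumes "path4 T Y1 Y2 Y3 Y4 \<in> measurable M (path_borel T)" "\<omega> \<in> space M"
  shows "continuous_on {0..T} (\<lambda>t. Y1 t \<omega>)"
proof -
  have "path4 T Y1 Y2 Y3 Y4 \<omega> \<in> mspace (path_space T)"
    using measurable_space[OF assms] by (simp add: space_path_borel)
  then have "continuous_on {0..T} (path4 T Y1 Y2 Y3 Y4 \<omega>)"
    by (simp add: path_space_def)
  then have "continuous_on {0..T} (\<lambda>t. fst (path4 T Y1 Y2 Y3 Y4 \<omega> t))"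
    by (rule continuous_on_fst)
  then show ?thesis
    by (rule continuous_on_eq) (simp add: path4_def)
qed

lemma path4_measurable_component:
  assumes "path4 T Y1 Y2 Y3 Y4 \<in> measurable M (path_borel T)" and t: "t \<in> {0..T}"
  shows "Y1 t \<in> borel_measurable M"
proof -
  have "(\<lambda>\<omega>. fst (path4 T Y1 Y2 Y3 Y4 \<omega> t)) \<in> borel_measurable M"
    by (rule measurable_compose[OF measurable_compose[OF assms(1) path_eval_measurable[OF t]]
          borel_measurable_continuous_onI]) (intro continuous_intros)
  then show ?thesis using t by (simp add: path4_def)
qed

text \<open>A function of the first coordinate at two times is a measurable function of the path, so
  its integral depends on the path law alone. Two times suffice for increments; taking them equal
  covers the fourth moments.\<close>

lemma equal_in_law_path4_nn_integral:
  assumes E: "equal_in_law (path_borel T) M (path4 T Y1 Y2 Y3 Y4) M' (path4 T Y1' Y2' Y3' Y4')"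
    and st: "s \<in> {0..T}" "t \<in> {0..T}"
    and [measurable]: "g \<in> borel_measurable (borel :: (real \<times> real) measure)"
  shows "(\<integral>\<^sup>+\<omega>. g (Y1' s \<omega>, Y1' t \<omega>) \<partial>M') = (\<integral>\<^sup>+\<omega>. g (Y1 s \<omega>, Y1 t \<omega>) \<partial>M)"
proof -
  have fst_eval [measurable]: "(\<lambda>p. fst (p r)) \<in> borel_measurable (path_borel T)" if "r \<in> {0..T}" for r
    by (rule measurable_compose[OF path_eval_measurable[OF that] borel_measurable_continuous_onI])
      (intro continuous_intros)
  note [measurable] = fst_eval[OF st(1)] fst_eval[OF st(2)]
  let ?g = "\<lambda>p :: real \<Rightarrow> real4. g (fst (p s), fst (p t))"
  have m: "?g \<in> borel_measurable (path_borel T)" by measurable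
  from E have Y: "path4 T Y1 Y2 Y3 Y4 \<in> measurable M (path_borel T)"
    and Y': "path4 T Y1' Y2' Y3' Y4' \<in> measurable M' (path_borel T)"
    and d: "distr M (path_borel T) (path4 T Y1 Y2 Y3 Y4) = distr M' (path_borel T) (path4 T Y1' Y2' Y3' Y4')"
    by (auto simp: equal_in_law_def)
  show ?thesis
    using nn_integral_distr[OF Y, of ?g] nn_integral_distr[OF Y', of ?g] m d st by (simp add: path4_def)
qed

text \<open>The path metric dominates the distance at each time, and that distance dominates the one
  between first coordinates.\<close>

lemma path4_limitin_uniform:
  assumes "limitin (mtopology_of (path_space T))
      (\<lambda>l. path4 T (Y1 l) (Y2 l) (Y3 l) (Y4 l) \<omega>) (path4 T Z1 Z2 Z3 Z4 \<omega>) sequentially"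
  shows "uniform_limit {0..T} (\<lambda>l t. Y1 l t \<omega>) (\<lambda>t. Z1 t \<omega>) sequentially"
proof (rule uniform_limitI)
  fix e :: real assume e: "e > 0"
  let ?S = "path_space T"
  let ?p = "\<lambda>l. path4 T (Y1 l) (Y2 l) (Y3 l) (Y4 l) \<omega>" and ?q = "path4 T Z1 Z2 Z3 Z4 \<omega>"
  from assms have q: "?q \<in> mspace ?S"
    and ev: "\<forall>e>0. \<forall>\<^sub>F l in sequentially. ?p l \<in> mspace ?S \<and> mdist ?S (?p l) ?q < e"
    unfolding mtopology_of_def Metric_space.limitin_metric[OF Metric_space_mspace_mdist] by auto
  from ev[rule_format, OF e] show "\<forall>\<^sub>F l in sequentially. \<forall>t\<in>{0..T}. dist (Y1 l t \<omega>) (Z1 t \<omega>) < e"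
  proof eventually_elim
    case (elim l)
    show ?case
    proof
      fix t assume t: "t \<in> {0..T}"
      have "dist (?p l t) (?q t) \<le> mdist ?S (?p l) ?q"
        using mdist_cfunspace_imp_mdist_le[of "?p l" "top_of_set {0..T}" euclidean_metric ?q _ t] elim q t
        by (simp add: path_space_def)
      moreover have "dist (fst (?p l t)) (fst (?q t)) \<le> dist (?p l t) (?q t)" by (rule dist_fst_le)
      ultimately show "dist (Y1 l t \<omega>) (Z1 t \<omega>) < e" using elim t by (simp add: path4_def)
    qed
  qed
qed

section \<open>Mean square convergence, uniformly in time\<close>

lemma ennreal_tendsto_0I:
  assumes "\<And>r. 0 < r \<Longrightarrow> \<forall>\<^sub>F x in F. a x \<le> ennreal r"
  shows "(a \<longlongrightarrow> 0) F"
proof (rule order_tendstoI)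
  fix e :: ennreal assume "0 < e"
  then obtain r where r: "0 < ennreal r" "ennreal r < e"
    by (metis dense ennreal_cases infinity_ennreal_def not_less top_greatest)
  then have "0 < r" by simp
  from assms[OF this] show "\<forall>\<^sub>F x in F. a x < e" by eventually_elim (use r(2) in order)
qed simp

text \<open>Trades uniformity in t for sequences of times, so that dominated convergence, a
  statement about sequences, can be applied to a supremum.\<close>

lemma SUP_tendsto_0:
  fixes a :: "nat \<Rightarrow> 'c \<Rightarrow> ennreal"
  assumes "S \<noteq> {}" and a: "\<And>\<tau>. (\<And>l. \<tau> l \<in> S) \<Longrightarrow> (\<lambda>l. a l (\<tau> l)) \<longlonglongrightarrow> 0"
  shows "(\<lambda>l. SUP t\<in>S. a l t) \<longlonglongrightarrow> 0"
proof (rule ennreal_tendsto_0I)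
  fix r :: real assume r: "0 < r"
  \<comment> \<open>A time violating the threshold \<open>r\<close> if there is one, otherwise any
    element of \<open>S\<close>. If \<open>a l (\<tau> l)\<close> is below \<open>r\<close>, no
    element of \<open>S\<close> exceeds \<open>r\<close>.\<close>
  define \<tau> where "\<tau> l = (SOME t. t \<in> S \<and> ((\<exists>u\<in>S. ennreal r < a l u) \<longrightarrow> ennreal r < a l t))" for l
  have \<tau>: "\<tau> l \<in> S \<and> ((\<exists>u\<in>S. ennreal r < a l u) \<longrightarrow> ennreal r < a l (\<tau> l))" for l
    unfolding \<tau>_def by (rule someI_ex) (use \<open>S \<noteq> {}\<close> in blast)
  then have "(\<lambda>l. a l (\<tau> l)) \<longlonglongrightarrow> 0" using a by blast
  then have "\<forall>\<^sub>F l in sequentially. a l (\<tau> l) < ennreal r"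
    using r by (intro order_tendstoD(2)) auto
  then show "\<forall>\<^sub>F l in sequentially. (SUP t\<in>S. a l t) \<le> ennreal r"
    by eventually_elim (intro SUP_least, use \<tau> in \<open>meson not_less order_less_asym\<close>)
qed

text \<open>Bounded fourth moments give uniform integrability of the squares, in the form x^2 <= min
  (x^2) K + x^4 / K. The truncated part converges by domination by the constant \<open>K\<close>,
  integrable for a finite measure; the rest is small for large \<open>K\<close>.\<close>

lemma (in finite_measure) nn_integral_square_tendsto_0:
  fixes f :: "nat \<Rightarrow> 'a \<Rightarrow> real"
  assumes [measurable]: "\<And>k. f k \<in> borel_measurable M"
    and lim: "AE \<omega> in M. (\<lambda>k. f k \<omega>) \<longlonglongrightarrow> 0"
    and C: "\<And>k. (\<integral>\<^sup>+\<omega>. ennreal (f k \<omega> ^ 4) \<partial>M) \<le> ennreal C"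
  shows "(\<lambda>k. \<integral>\<^sup>+\<omega>. ennreal ((f k \<omega>)\<^sup>2) \<partial>M) \<longlonglongrightarrow> 0"
proof (rule ennreal_tendsto_0I)
  fix r :: real assume r: "0 < r"
  \<comment> \<open>Makes \<open>max C 1 / K\<close> equal to r / 2. The maximum with 1 keeps
    \<open>K\<close> positive whatever the sign of \<open>C\<close>.\<close>
  define K where "K = 2 * max C 1 / r"
  have K: "0 < K" using r by (simp add: K_def)
  have "(\<lambda>k. \<integral>\<^sup>+\<omega>. ennreal (min ((f k \<omega>)\<^sup>2) K) \<partial>M) \<longlonglongrightarrow> (\<integral>\<^sup>+\<omega>. 0 \<partial>M)"
  proof (rule nn_integral_dominated_convergence[where w = "\<lambda>_. ennreal K"])
    show "(\<integral>\<^sup>+\<omega>. ennreal K \<partial>M) < \<infinity>"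
      by (simp add: ennreal_mult_less_top emeasure_finite less_top[symmetric] ennreal_mult_eq_top_iff)
    show "AE \<omega> in M. (\<lambda>k. ennreal (min ((f k \<omega>)\<^sup>2) K)) \<longlonglongrightarrow> 0"
      using lim
    proof eventually_elim
      case (elim \<omega>)
      have "(\<lambda>k. min ((f k \<omega>)\<^sup>2) K) \<longlonglongrightarrow> min (0\<^sup>2) K"
        by (intro tendsto_intros elim)
      then have "(\<lambda>k. ennreal (min ((f k \<omega>)\<^sup>2) K)) \<longlonglongrightarrow> ennreal (min (0\<^sup>2) K)"
        by (rule tendsto_ennrealI)
      then show ?case using K by simp
    qed
  qed (auto intro!: ennreal_leI AE_I2)
  then have "\<forall>\<^sub>F k in sequentially. (\<integral>\<^sup>+\<omega>. ennreal (min ((f k \<omega>)\<^sup>2) K) \<partial>M) < ennreal (r / 2)"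
    using r by (intro order_tendstoD(2)) auto
  then show "\<forall>\<^sub>F k in sequentially. (\<integral>\<^sup>+\<omega>. ennreal ((f k \<omega>)\<^sup>2) \<partial>M) \<le> ennreal r"
  proof eventually_elim
    case (elim k)
    have sq: "x\<^sup>2 \<le> min (x\<^sup>2) K + inverse K * x ^ 4" for x :: real
    proof (cases "x\<^sup>2 \<le> K")
      case True
      then show ?thesis using K by simp
    next
      case False
      then have "x\<^sup>2 * K \<le> x\<^sup>2 * x\<^sup>2" by (intro mult_left_mono) auto
      then have "x\<^sup>2 \<le> inverse K * x ^ 4"
        using K by (simp add: field_simps power4_eq_xxxx power2_eq_square)
      then show ?thesis using K by (smt (verit) zero_le_power2 min_def)
    qed
    have "(\<integral>\<^sup>+\<omega>. ennreal ((f k \<omega>)\<^sup>2) \<partial>M) \<le>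
        (\<integral>\<^sup>+\<omega>. ennreal (min ((f k \<omega>)\<^sup>2) K) + ennreal (inverse K) * ennreal (f k \<omega> ^ 4) \<partial>M)"
      using K sq
      by (intro nn_integral_mono) (auto simp flip: ennreal_plus ennreal_mult intro!: ennreal_leI)
    also have "\<dots> = (\<integral>\<^sup>+\<omega>. ennreal (min ((f k \<omega>)\<^sup>2) K) \<partial>M) + ennreal (inverse K) * (\<integral>\<^sup>+\<omega>. ennreal (f k \<omega> ^ 4) \<partial>M)"
      by (simp add: nn_integral_add nn_integral_cmult)
    also have "\<dots> \<le> ennreal (r / 2) + ennreal (inverse K) * ennreal (max C 1)"
      using elim C[of k] by (intro add_mono mult_left_mono order_trans[OF C] ennreal_leI) auto
    also have "\<dots> = ennreal r"
      using r K by (simp flip: ennreal_plus ennreal_mult add: K_def)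
    finally show ?case .
  qed
qed

section \<open>The singular increment integral\<close>

lemma nn_integral_powr_end:
  fixes a t :: real
  assumes a: "0 < a" and t: "0 \<le> t"
  shows "(\<integral>\<^sup>+s\<in>{0..<t}. ennreal ((t - s) powr (a - 1)) \<partial>lborel) = ennreal (t powr a / a)"
proof -
  have "(\<integral>\<^sup>+s\<in>{0..<t}. ennreal ((t - s) powr (a - 1)) \<partial>lborel)
      = (\<integral>\<^sup>+x. ennreal ((t - (t + (- 1) * x)) powr (a - 1)) * indicator {0..<t} (t + (- 1) * x) \<partial>lborel)"
    by (subst nn_integral_real_affine[where c = "- 1" and t = t]) auto
  \<comment> \<open>The reflection x = t - s has moved the singularity to 0. The indicators differ
    only at x = 0, where \<open>0 powr (a - 1)\<close> is 0, so the integrands agree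
    pointwise.\<close>
  also have "\<dots> = (\<integral>\<^sup>+x. ennreal (x powr (a - 1)) * indicator {0..t} x \<partial>lborel)"
    by (intro nn_integral_cong) (auto simp: indicator_def)
  also have "\<dots> = ennreal (t powr (a - 1 + 1) / (a - 1 + 1))"
    using has_integral_powr_from_0[of "a - 1" t] a t by (intro nn_integral_has_integral_lebesgue') auto
  finally show ?thesis by simp
qed

text \<open>The minimum of two nonnegative numbers is at most any weighted geometric mean of
  them.\<close>

lemma le_ennreal_interpolate:
  assumes "u \<le> ennreal P" "u \<le> ennreal Q" and PQ: "0 \<le> P" "0 \<le> Q" and \<theta>: "0 \<le> \<theta>" "\<theta> \<le> 1"
  shows "u \<le> ennreal (P powr \<theta> * Q powr (1 - \<theta>))"
proof -
  have "min P Q \<le> P powr \<theta> * Q powr (1 - \<theta>)"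
  proof -
    have "min P Q = min P Q powr \<theta> * min P Q powr (1 - \<theta>)"
      using PQ by (simp add: powr_add[symmetric])
    also have "\<dots> \<le> P powr \<theta> * Q powr (1 - \<theta>)"
      using PQ \<theta> by (intro mult_mono powr_mono2) auto
    finally show ?thesis .
  qed
  moreover have "u \<le> ennreal (min P Q)" using assms(1,2) by (auto simp: min_def)
  ultimately show ?thesis by (meson ennreal_leI order_trans)
qed

text \<open>Joint measurability, needed to exchange the integrals over time and over the probability
  space. A process with continuous paths is the pointwise limit of its time discretizations.\<close>

lemma borel_measurable_pair_continuous:
  fixes D :: "real \<Rightarrow> 'b \<Rightarrow> real"
  assumes [measurable]: "\<And>s. D s \<in> borel_measurable M"
    and cont: "\<And>\<omega>. \<omega> \<in> space M \<Longrightarrow> continuous_on UNIV (\<lambda>s. D s \<omega>)"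
  shows "(\<lambda>x. D (fst x) (snd x)) \<in> borel_measurable (borel \<Otimes>\<^sub>M M)"
proof (rule borel_measurable_LIMSEQ_real)
  \<comment> \<open>Rounding down to a grid of mesh 1 / (n + 1): the floor takes countably many
    values, and on each of them only one time is involved.\<close>
  let ?r = "\<lambda>n s :: real. real_of_int \<lfloor>s * real (Suc n)\<rfloor> / real (Suc n)"
  show "(\<lambda>x. D (?r n (fst x)) (snd x)) \<in> borel_measurable (borel \<Otimes>\<^sub>M M)" for n
    by (rule measurable_compose_countable[where f = "\<lambda>i x. D (real_of_int i / real (Suc n)) (snd x)"
        and g = "\<lambda>x. \<lfloor>fst x * real (Suc n)\<rfloor>"]) measurable
  fix x assume "x \<in> space (borel \<Otimes>\<^sub>M M :: (real \<times> 'b) measure)"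
  then have x: "snd x \<in> space M" by (auto simp: space_pair_measure)
  have "(\<lambda>n. ?r n (fst x)) \<longlonglongrightarrow> fst x"
  proof (rule tendsto_sandwich)
    show "(\<lambda>n. fst x - 1 / real (Suc n)) \<longlonglongrightarrow> fst x"
      using tendsto_diff[OF tendsto_const LIMSEQ_Suc[OF lim_1_over_n], of "fst x"] by simp
    have "real_of_int \<lfloor>y\<rfloor> / m \<le> y / m \<and> y / m - 1 / m \<le> real_of_int \<lfloor>y\<rfloor> / m" if "m > 0" for y m :: real
      using that by (auto simp: divide_right_mono simp flip: diff_divide_distrib intro!: divide_right_mono)
    from this[of "real (Suc n)" "fst x * real (Suc n)" for n]
    show "\<forall>\<^sub>F n in sequentially. fst x - 1 / real (Suc n) \<le> ?r n (fst x)"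
      and "\<forall>\<^sub>F n in sequentially. ?r n (fst x) \<le> fst x"
      by (simp_all del: of_nat_Suc)
  qed simp
  from continuous_on_tendsto_compose[OF cont[OF x] this]
  show "(\<lambda>n. D (?r n (fst x)) (snd x)) \<longlonglongrightarrow> D (fst x) (snd x)" by simp
qed

text \<open>
  Cauchy--Schwarz with the weight \<open>(t - s) powr ((H - \<beta>) / 2 - 1)\<close>; the second moment of the increment
  is interpolated between its Hoelder bound and four times the uniform bound \<open>e\<close>, which leaves
  exactly the same weight in the second factor.
\<close>
lemma besov_increment_bound:
  fixes D :: "real \<Rightarrow> 'b \<Rightarrow> real"
  assumes "prob_space M" and \<beta>: "0 < \<beta>" "\<beta> < H" and t: "t \<in> {0..T}"
    and meas: "\<And>s. s \<in> {0..T} \<Longrightarrow> D s \<in> borel_measurable M"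
    and cont: "\<And>\<omega>. \<omega> \<in> space M \<Longrightarrow> continuous_on {0..T} (\<lambda>s. D s \<omega>)"
    and A: "0 \<le> A" "\<And>s. s \<in> {0..T} \<Longrightarrow>
      (\<integral>\<^sup>+\<omega>. ennreal ((D t \<omega> - D s \<omega>)\<^sup>2) \<partial>M) \<le> ennreal (A * \<bar>t - s\<bar> powr (2 * H))"
    and e: "0 \<le> e" "\<And>s. s \<in> {0..T} \<Longrightarrow> (\<integral>\<^sup>+\<omega>. ennreal ((D s \<omega>)\<^sup>2) \<partial>M) \<le> ennreal e"
  defines "d \<equiv> (H - \<beta>) / 2" and "\<theta> \<equiv> (H + \<beta>) / (2 * H)"
  shows "(\<integral>\<^sup>+\<omega>. (\<integral>\<^sup>+s\<in>{0..<t}. ennreal (\<bar>D t \<omega> - D s \<omega>\<bar> / (t - s) powr (1 + \<beta>)) \<partial>lborel)\<^sup>2 \<partial>M)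
    \<le> ennreal ((T powr d / d)\<^sup>2 * (A powr \<theta> * (4 * e) powr (1 - \<theta>)))"
proof -
  interpret prob_space M by fact
  interpret pair_sigma_finite lborel M ..
  have d: "0 < d" using \<beta> by (simp add: d_def)
  \<comment> \<open>The exponent 2 * H * \<open>\<theta>\<close> = H + \<open>\<beta>\<close> is the
    midpoint of 2 * \<open>\<beta>\<close> and 2 * H, and equals 2 * \<open>\<beta>\<close> + 2 * d.
    Against the power - 2 - 2 * \<open>\<beta>\<close> - (d - 1) in the square of \<open>g\<close>
    below, it leaves exactly d - 1.\<close>
  have \<theta>: "0 \<le> \<theta>" "\<theta> \<le> 1" "2 * H * \<theta> = H + \<beta>" using \<beta> by (auto simp: \<theta>_def field_simps)
  define Q where "Q = A powr \<theta> * (4 * e) powr (1 - \<theta>)"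
  have Q: "0 \<le> Q" by (simp add: Q_def)
  \<comment> \<open>Clamping the time to [0, T] extends the paths continuously to the whole line, as
    \<open>borel_measurable_pair_continuous\<close> requires, and changes nothing on [0, t).\<close>
  define E where "E s \<omega> = D (max 0 (min T s)) \<omega>" for s \<omega>
  have E: "E s = D s" if "s \<in> {0..<t}" for s using that t by (auto simp: E_def fun_eq_iff)
  have T: "0 \<le> T" using t by auto
  have Em [measurable]: "E s \<in> borel_measurable M" for s
    using meas[of "max 0 (min T s)"] T unfolding E_def by auto
  have [measurable]: "D t \<in> borel_measurable M" using meas t .
  have E_pair [measurable]: "(\<lambda>x. E (fst x) (snd x)) \<in> borel_measurable (borel \<Otimes>\<^sub>M M)"
  proof (rule borel_measurable_pair_continuous)
    fix \<omega> assume \<omega>: "\<omega> \<in> space M"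
    show "continuous_on UNIV (\<lambda>s. E s \<omega>)"
      unfolding E_def using T
      by (intro continuous_on_compose2[OF cont[OF \<omega>]] continuous_intros) auto
  qed simp
  \<comment> \<open>\<open>f\<close> is the square root of the weight, and the exponent in
    \<open>g\<close> is what remains of -(1 + \<open>\<beta>\<close>).\<close>
  define f where "f s = ennreal ((t - s) powr ((d - 1) / 2)) * indicator {0..<t} s" for s
  define g where "g s \<omega> = ennreal (\<bar>D t \<omega> - E s \<omega>\<bar> * (t - s) powr (- (1 + \<beta>) - (d - 1) / 2)) * indicator {0..<t} s" for s \<omega>
  have [measurable]: "f \<in> borel_measurable lborel" unfolding f_def by measurable
  have g_pair [measurable]: "(\<lambda>x. g (fst x) (snd x)) \<in> borel_measurable (lborel \<Otimes>\<^sub>M M)"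
    unfolding g_def by measurable
  \<comment> \<open>The swapped order serves the inner time integral, which must be measurable in
    the random parameter.\<close>
  have [measurable]: "(\<lambda>x. E (snd x) (fst x)) \<in> borel_measurable (M \<Otimes>\<^sub>M borel)"
    using measurable_pair_swap[OF E_pair] by (simp add: case_prod_beta')
  have [measurable]: "(\<lambda>x. g (snd x) (fst x)) \<in> borel_measurable (M \<Otimes>\<^sub>M borel)"
    unfolding g_def by measurable
  have gm [measurable]: "(\<lambda>s. g s \<omega>) \<in> borel_measurable lborel" if "\<omega> \<in> space M" for \<omega>
    using measurable_compose[OF measurable_Pair2' g_pair, of \<omega>] that by simp
  have F: "(\<integral>\<^sup>+s. (f s)\<^sup>2 \<partial>lborel) = ennreal (t powr d / d)"
  proof -
    have "(\<integral>\<^sup>+s. (f s)\<^sup>2 \<partial>lborel) = (\<integral>\<^sup>+s\<in>{0..<t}. ennreal ((t - s) powr (d - 1)) \<partial>lborel)"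
      by (intro nn_integral_cong)
        (auto simp: f_def power2_eq_square indicator_def ennreal_mult[symmetric] powr_add[symmetric])
    also have "\<dots> = ennreal (t powr d / d)" using d t by (intro nn_integral_powr_end) auto
    finally show ?thesis .
  qed
  have G: "(\<integral>\<^sup>+\<omega>. (g s \<omega>)\<^sup>2 \<partial>M) \<le> ennreal Q * (ennreal ((t - s) powr (d - 1)) * indicator {0..<t} s)" for s
  proof (cases "s \<in> {0..<t}")
    case True
    then have s: "s \<in> {0..T}" using t by auto
    note [measurable] = meas[OF s]
    define w where "w = (t - s) powr (- 2 - 2 * \<beta> - (d - 1))"
    have "(\<integral>\<^sup>+\<omega>. (g s \<omega>)\<^sup>2 \<partial>M) = (\<integral>\<^sup>+\<omega>. ennreal w * ennreal ((D t \<omega> - D s \<omega>)\<^sup>2) \<partial>M)"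
    proof (intro nn_integral_cong)
      fix \<omega>
      have "((t - s) powr (- (1 + \<beta>) - (d - 1) / 2))\<^sup>2 = w"
        unfolding w_def power2_eq_square powr_add[symmetric] by (simp add: algebra_simps)
      then show "(g s \<omega>)\<^sup>2 = ennreal w * ennreal ((D t \<omega> - D s \<omega>)\<^sup>2)"
        using True by (simp add: g_def E[OF True] ennreal_power power_mult_distrib ennreal_mult[symmetric] mult.commute w_def)
    qed
    also have "\<dots> = ennreal w * (\<integral>\<^sup>+\<omega>. ennreal ((D t \<omega> - D s \<omega>)\<^sup>2) \<partial>M)"
      by (simp add: nn_integral_cmult)
    also have "\<dots> \<le> ennreal w * ennreal ((A * \<bar>t - s\<bar> powr (2 * H)) powr \<theta> * (4 * e) powr (1 - \<theta>))"
    proof (intro mult_left_mono le_ennreal_interpolate A(2)[OF s] \<theta>)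
      have "(\<integral>\<^sup>+\<omega>. ennreal ((D t \<omega> - D s \<omega>)\<^sup>2) \<partial>M)
          \<le> (\<integral>\<^sup>+\<omega>. 2 * (ennreal ((D t \<omega>)\<^sup>2) + ennreal ((D s \<omega>)\<^sup>2)) \<partial>M)"
      proof (intro nn_integral_mono)
        fix \<omega>
        have "(x - y)\<^sup>2 \<le> 2 * (x\<^sup>2 + y\<^sup>2)" for x y :: real
          using square_add_le[of x "- y"] by simp
        from ennreal_leI[OF this[of "D t \<omega>" "D s \<omega>"]]
        show "ennreal ((D t \<omega> - D s \<omega>)\<^sup>2) \<le> 2 * (ennreal ((D t \<omega>)\<^sup>2) + ennreal ((D s \<omega>)\<^sup>2))"
          by (simp add: ennreal_mult)
      qed
      also have "\<dots> = 2 * ((\<integral>\<^sup>+\<omega>. ennreal ((D t \<omega>)\<^sup>2) \<partial>M) + (\<integral>\<^sup>+\<omega>. ennreal ((D s \<omega>)\<^sup>2) \<partial>M))"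
        by (simp add: nn_integral_cmult nn_integral_add)
      also have "\<dots> \<le> 2 * (ennreal e + ennreal e)"
        using e(2)[OF s] e(2)[OF t] by (intro mult_left_mono add_mono) auto
      also have "\<dots> = ennreal (2 * (e + e))" using e(1) by (simp only: ennreal_plus ennreal_mult) (simp add: ennreal_mult)
      finally show "(\<integral>\<^sup>+\<omega>. ennreal ((D t \<omega> - D s \<omega>)\<^sup>2) \<partial>M) \<le> ennreal (4 * e)" by simp
    qed (use A e in auto)
    also have "\<dots> = ennreal (Q * ((t - s) powr (H + \<beta>) * w))"
    proof -
      have "(A * \<bar>t - s\<bar> powr (2 * H)) powr \<theta> = A powr \<theta> * (t - s) powr (H + \<beta>)"
        using True A(1) \<theta>(3) by (simp add: powr_mult powr_powr)
      then show ?thesis by (simp add: Q_def w_def ennreal_mult[symmetric] mult_ac)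
    qed
    also have "(t - s) powr (H + \<beta>) * w = (t - s) powr (d - 1)"
      unfolding w_def powr_add[symmetric] by (simp add: d_def field_simps)
    finally show ?thesis using True Q by (simp add: ennreal_mult)
  qed (simp add: g_def)
  have "(\<integral>\<^sup>+\<omega>. (\<integral>\<^sup>+s\<in>{0..<t}. ennreal (\<bar>D t \<omega> - D s \<omega>\<bar> / (t - s) powr (1 + \<beta>)) \<partial>lborel)\<^sup>2 \<partial>M)
      = (\<integral>\<^sup>+\<omega>. (\<integral>\<^sup>+s. f s * g s \<omega> \<partial>lborel)\<^sup>2 \<partial>M)"
  proof (intro nn_integral_cong arg_cong[where f = "\<lambda>x. x\<^sup>2"])
    fix \<omega> s
    show "ennreal (\<bar>D t \<omega> - D s \<omega>\<bar> / (t - s) powr (1 + \<beta>)) * indicator {0..<t} s = f s * g s \<omega>"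
    proof (cases "s \<in> {0..<t}")
      case True
      have "(t - s) powr ((d - 1) / 2) * (\<bar>D t \<omega> - D s \<omega>\<bar> * (t - s) powr (- (1 + \<beta>) - (d - 1) / 2))
        = \<bar>D t \<omega> - D s \<omega>\<bar> * ((t - s) powr ((d - 1) / 2) * (t - s) powr (- (1 + \<beta>) - (d - 1) / 2))"
        by (simp add: mult_ac)
      also have "\<dots> = \<bar>D t \<omega> - D s \<omega>\<bar> / (t - s) powr (1 + \<beta>)"
      proof -
        have "(d - 1) / 2 + (- (1 + \<beta>) - (d - 1) / 2) = - (1 + \<beta>)" by simp
        then show ?thesis unfolding powr_add[symmetric] by (simp only: powr_minus divide_inverse)
      qed
      finally show ?thesis using True by (simp add: f_def g_def E[OF True] ennreal_mult[symmetric])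
    qed (simp add: f_def)
  qed
  also have "\<dots> \<le> (\<integral>\<^sup>+\<omega>. (\<integral>\<^sup>+s. (f s)\<^sup>2 \<partial>lborel) * (\<integral>\<^sup>+s. (g s \<omega>)\<^sup>2 \<partial>lborel) \<partial>M)"
    by (intro nn_integral_mono Cauchy_Schwarz_nn_integral gm) auto
  also have "\<dots> = ennreal (t powr d / d) * (\<integral>\<^sup>+\<omega>. (\<integral>\<^sup>+s. (g s \<omega>)\<^sup>2 \<partial>lborel) \<partial>M)"
    unfolding F by (intro nn_integral_cmult) measurable
  also have "(\<integral>\<^sup>+\<omega>. (\<integral>\<^sup>+s. (g s \<omega>)\<^sup>2 \<partial>lborel) \<partial>M) = (\<integral>\<^sup>+s. (\<integral>\<^sup>+\<omega>. (g s \<omega>)\<^sup>2 \<partial>M) \<partial>lborel)"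
    using Fubini[of "\<lambda>x. (g (fst x) (snd x))\<^sup>2"] by simp
  also have "\<dots> \<le> (\<integral>\<^sup>+s. ennreal Q * (ennreal ((t - s) powr (d - 1)) * indicator {0..<t} s) \<partial>lborel)"
    by (intro nn_integral_mono G)
  also have "\<dots> = ennreal Q * ennreal (t powr d / d)"
    using nn_integral_powr_end[OF d, of t] t by (simp add: nn_integral_cmult)
  also have "ennreal (t powr d / d) * (ennreal Q * ennreal (t powr d / d)) = ennreal ((t powr d / d)\<^sup>2 * Q)"
    using d Q by (simp add: power2_eq_square mult_ac flip: ennreal_mult)
  \<comment> \<open>Replacing t by T makes the bound uniform in t, ready for the supremum.\<close>
  also have "\<dots> \<le> ennreal ((T powr d / d)\<^sup>2 * Q)"
    using d Q t by (intro ennreal_leI mult_right_mono power_mono divide_right_mono powr_mono2) auto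
  finally show ?thesis by (simp add: Q_def mult_left_mono)
qed

text \<open>At every t both terms of the functional are controlled by the single number
  \<open>e l\<close>: the first linearly, the second through its power 1 -
  \<open>\<theta>\<close>.\<close>

lemma besov_norm_tendsto_0:
  fixes D :: "nat \<Rightarrow> real \<Rightarrow> 'b \<Rightarrow> real"
  assumes P: "prob_space M" and T: "0 \<le> T" and \<beta>: "0 < \<beta>" "\<beta> < H"
    and meas: "\<And>l s. s \<in> {0..T} \<Longrightarrow> D l s \<in> borel_measurable M"
    and cont: "\<And>l \<omega>. \<omega> \<in> space M \<Longrightarrow> continuous_on {0..T} (\<lambda>s. D l s \<omega>)"
    and A: "0 \<le> A" "\<And>l s t. s \<in> {0..T} \<Longrightarrow> t \<in> {0..T} \<Longrightarrow>
      (\<integral>\<^sup>+\<omega>. ennreal ((D l t \<omega> - D l s \<omega>)\<^sup>2) \<partial>M) \<le> ennreal (A * \<bar>t - s\<bar> powr (2 * H))"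
    and C: "\<And>l t. t \<in> {0..T} \<Longrightarrow> (\<integral>\<^sup>+\<omega>. ennreal (D l t \<omega> ^ 4) \<partial>M) \<le> ennreal C"
    and lim: "AE \<omega> in M. uniform_limit {0..T} (\<lambda>l t. D l t \<omega>) (\<lambda>_. 0) sequentially"
  shows "(\<lambda>l. besov_norm M T \<beta> (D l)) \<longlonglongrightarrow> 0"
proof -
  interpret prob_space M by fact
  define d where "d = (H - \<beta>) / 2"
  define \<theta> where "\<theta> = (H + \<beta>) / (2 * H)"
  define e where "e l = (SUP t\<in>{0..T}. \<integral>\<^sup>+\<omega>. ennreal ((D l t \<omega>)\<^sup>2) \<partial>M)" for l
  have e: "e \<longlonglongrightarrow> 0"
    unfolding e_def
  proof (rule SUP_tendsto_0)
    fix \<tau> :: "nat \<Rightarrow> real" assume \<tau>: "\<And>l. \<tau> l \<in> {0..T}"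
    show "(\<lambda>l. \<integral>\<^sup>+\<omega>. ennreal ((D l (\<tau> l) \<omega>)\<^sup>2) \<partial>M) \<longlonglongrightarrow> 0"
    proof (rule nn_integral_square_tendsto_0[where C = C])
      \<comment> \<open>The times move with l, so convergence at each fixed time would not be enough
        here.\<close>
      show "AE \<omega> in M. (\<lambda>l. D l (\<tau> l) \<omega>) \<longlonglongrightarrow> 0"
        using lim
      proof eventually_elim
        case (elim \<omega>)
        show ?case
        proof (rule tendstoI)
          fix r :: real assume "0 < r"
          from uniform_limitD[OF elim this] show "\<forall>\<^sub>F l in sequentially. dist (D l (\<tau> l) \<omega>) 0 < r"
            by eventually_elim (use \<tau> in auto)
        qed
      qed
    qed (use meas C \<tau> in auto)
  qed (use T in auto)
  \<comment> \<open>The real power in the bound needs a real number, whereas \<open>e l\<close> may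
    be infinite for small l. Once \<open>e l < 1\<close>, the conversion loses nothing.\<close>
  define r where "r l = enn2real (e l)" for l
  have "r = (\<lambda>l. enn2real (e l))" by (simp add: r_def fun_eq_iff)
  then have r: "r \<longlonglongrightarrow> 0"
    using tendsto_enn2real[of e 0 sequentially] e by simp
  have "\<forall>\<^sub>F l in sequentially. e l < 1" using e by (rule order_tendstoD) simp
  then have er: "\<forall>\<^sub>F l in sequentially. e l = ennreal (r l)"
    by eventually_elim (auto simp: r_def ennreal_enn2real_if)
  \<comment> \<open>Here \<open>\<beta> < H\<close> enters strictly: a positive power of
    \<open>r l\<close> survives and drives the increment term to 0.\<close>
  have \<theta>: "\<theta> < 1" using \<beta> by (simp add: \<theta>_def field_simps)
  let ?b = "\<lambda>l. (T powr d / d)\<^sup>2 * (A powr \<theta> * (4 * r l) powr (1 - \<theta>))"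
  have "(\<lambda>l. r l + ?b l) \<longlonglongrightarrow> 0 + (T powr d / d)\<^sup>2 * (A powr \<theta> * (4 * 0) powr (1 - \<theta>))"
    using \<theta> by (intro tendsto_intros r tendsto_powr2 eventuallyI tendsto_mult_right_zero) (auto simp: r_def)
  then have "(\<lambda>l. ennreal (r l + ?b l)) \<longlonglongrightarrow> 0"
    using tendsto_ennrealI[of "\<lambda>l. r l + ?b l" 0] by simp
  then show ?thesis
  proof (rule tendsto_sandwich[OF _ _ tendsto_const, rotated 2])
    show "\<forall>\<^sub>F l in sequentially. besov_norm M T \<beta> (D l) \<le> ennreal (r l + ?b l)"
      using er
    proof eventually_elim
      case (elim l)
      have r0: "0 \<le> r l" by (simp add: r_def)
      have le: "(\<integral>\<^sup>+\<omega>. ennreal ((D l s \<omega>)\<^sup>2) \<partial>M) \<le> ennreal (r l)" if "s \<in> {0..T}" for s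
        unfolding elim[symmetric] e_def using that by (rule SUP_upper)
      show ?case
        unfolding besov_norm_def
      proof (rule SUP_least)
        fix t assume t: "t \<in> {0..T}"
        have "(\<integral>\<^sup>+\<omega>. (\<integral>\<^sup>+s\<in>{0..<t}. ennreal (\<bar>D l t \<omega> - D l s \<omega>\<bar> / (t - s) powr (1 + \<beta>)) \<partial>lborel)\<^sup>2 \<partial>M) \<le> ennreal (?b l)"
          unfolding d_def \<theta>_def
          by (rule besov_increment_bound[OF P \<beta> t meas cont A(1) A(2)[OF _ t] r0 le])
        from add_mono[OF le[OF t] this]
        show "(\<integral>\<^sup>+\<omega>. ennreal ((D l t \<omega>)\<^sup>2) \<partial>M) +
            (\<integral>\<^sup>+\<omega>. (\<integral>\<^sup>+s\<in>{0..<t}. ennreal (\<bar>D l t \<omega> - D l s \<omega>\<bar> / (t - s) powr (1 + \<beta>)) \<partial>lborel)\<^sup>2 \<partial>M)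
            \<le> ennreal (r l + ?b l)"
          using r0 by (simp add: ennreal_plus)
      qed
    qed
  qed simp
qed

section \<open>Bounds for the limit process, and the theorem\<close>

text \<open>Fatou's lemma; almost everywhere the limit coincides with the liminf of the
  sequence.\<close>

lemma nn_integral_limit_le:
  fixes f :: "nat \<Rightarrow> 'a \<Rightarrow> real"
  assumes [measurable]: "\<And>l. f l \<in> borel_measurable M"
    and lim: "AE \<omega> in M. (\<lambda>l. f l \<omega>) \<longlonglongrightarrow> g \<omega>"
    and K: "\<And>l. (\<integral>\<^sup>+\<omega>. ennreal (f l \<omega>) \<partial>M) \<le> K"
  shows "(\<integral>\<^sup>+\<omega>. ennreal (g \<omega>) \<partial>M) \<le> K"
proof -
  have "AE \<omega> in M. ennreal (g \<omega>) = liminf (\<lambda>l. ennreal (f l \<omega>))"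
    using lim
  proof eventually_elim
    case (elim \<omega>)
    from lim_imp_Liminf[OF _ tendsto_ennrealI[OF elim]] show ?case by simp
  qed
  then have "(\<integral>\<^sup>+\<omega>. ennreal (g \<omega>) \<partial>M) = (\<integral>\<^sup>+\<omega>. liminf (\<lambda>l. ennreal (f l \<omega>)) \<partial>M)"
    by (rule nn_integral_cong_AE)
  also have "\<dots> \<le> liminf (\<lambda>l. \<integral>\<^sup>+\<omega>. ennreal (f l \<omega>) \<partial>M)"
    by (intro nn_integral_liminf) simp
  also have "\<dots> \<le> liminf (\<lambda>l :: nat. K)"
    by (intro Liminf_mono always_eventually allI K)
  finally show ?thesis by (simp add: Liminf_const)
qed

theorem proposition4p5:
  fixes M :: "'a measure" and M' :: "'b measure"
    and T H1 H2 x0 \<beta> :: real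
    and b :: "real \<Rightarrow> real \<Rightarrow> real"
    and W B1 B2 :: "real \<Rightarrow> 'a \<Rightarrow> real"
    and XN :: "nat \<Rightarrow> real \<Rightarrow> 'a \<Rightarrow> real"
    and N :: "nat \<Rightarrow> nat"
    and X' B1' B2' :: "nat \<Rightarrow> real \<Rightarrow> 'b \<Rightarrow> real"
    and X D Z Y :: "real \<Rightarrow> 'b \<Rightarrow> real"
  assumes "0 < T" and "0 < H1" "H1 \<le> 1/2" and "1/2 < H2" "H2 < 1"
    and b_measurable:
      "(\<lambda>(t, x). b t x) \<in> borel_measurable (restrict_space borel ({0..T} \<times> (UNIV :: real set)))"
    and "bounded_drift T b" and "piecewise_lipschitz_drift T b"
    and "prob_space M" and "completely_correlated_fbms M T W H1 H2 B1 B2"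
    and solutions: "\<And>n. 1 \<le> n \<Longrightarrow> strong_solution M T W x0 b n B1 B2 (XN n)"
    and subsequence: "strict_mono N" "\<And>l. 1 \<le> N l"
    and "prob_space M'"
    and versions:
      "\<And>l. equal_in_law (path_borel T)
          M (path4 T (XN (N l)) (drift_integral b (XN (N l))) (\<lambda>t \<omega>. B1 t \<omega> / real (N l)) B2)
          M' (path4 T (X' l) (drift_integral b (X' l)) (\<lambda>t \<omega>. B1' l t \<omega> / real (N l)) (B2' l))"
    and "\<And>l. satisfies_sde M' T x0 b (N l) (B1' l) (B2' l) (X' l)"
    and limit_measurable: "path4 T X D Z Y \<in> measurable M' (path_borel T)"
    and as_convergence:
      "AE \<omega> in M'. limitin (mtopology_of (path_space T))
          (\<lambda>l. path4 T (X' l) (drift_integral b (X' l)) (\<lambda>t \<omega>. B1' l t \<omega> / real (N l)) (B2' l) \<omega>)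
          (path4 T X D Z Y \<omega>) sequentially"
    and "0 < \<beta>" "\<beta> < H1"
  shows "(\<lambda>l. besov_norm M' T \<beta> (\<lambda>t \<omega>. X' l t \<omega> - X t \<omega>)) \<longlonglongrightarrow> 0"
proof -
  interpret M': prob_space M' by fact
  obtain c where c: "\<And>t x. t \<in> {0..T} \<Longrightarrow> \<bar>b t x\<bar> \<le> c"
    using \<open>bounded_drift T b\<close> unfolding bounded_drift_def by blast
  have B: "fractional_brownian_motion M T H1 B1" "fractional_brownian_motion M T H2 B2"
    using \<open>completely_correlated_fbms M T W H1 H2 B1 B2\<close>
    by (auto simp: completely_correlated_fbms_def volterra_fbm_def)
  define K where "K = 3 * (c\<^sup>2 * T powr (2 - 2 * H1) + 1 + T powr (2 * H2 - 2 * H1))"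
  define C where "C = 64 * (x0 ^ 4 + (c * T) ^ 4 + 3 * T powr (4 * H1) + 3 * T powr (4 * H2))"
  have K: "0 \<le> K" and C: "0 \<le> C" by (auto simp: K_def C_def)
  have cont_XN: "continuous_on {0..T} (\<lambda>t. XN (N l) t \<omega>)" if "\<omega> \<in> space M" for l \<omega>
    using solutions[OF subsequence(2)] that unfolding strong_solution_def by blast
  have sde: "satisfies_sde M T x0 b (N l) B1 B2 (XN (N l))" for l
    using solutions[OF subsequence(2)] unfolding strong_solution_def by blast
  note moments = satisfies_sde_moments[OF \<open>prob_space M\<close> \<open>0 < T\<close> \<open>0 < H1\<close> _ _ B b_measurable c cont_XN sde
      subsequence(2)]
  have H: "H1 \<le> H2" "H2 \<le> 1" using \<open>H1 \<le> 1/2\<close> \<open>1/2 < H2\<close> \<open>H2 < 1\<close> by auto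
  have X'_path: "path4 T (X' l) (drift_integral b (X' l)) (\<lambda>t \<omega>. B1' l t \<omega> / real (N l)) (B2' l)
      \<in> measurable M' (path_borel T)" for l
    using versions[of l] by (simp add: equal_in_law_def)
  have m [measurable]: "X' l t \<in> borel_measurable M'" "X t \<in> borel_measurable M'" if "t \<in> {0..T}" for l t
    using path4_measurable_component[OF X'_path that] path4_measurable_component[OF limit_measurable that]
    by auto
  have lim: "AE \<omega> in M'. uniform_limit {0..T} (\<lambda>l t. X' l t \<omega>) (\<lambda>t. X t \<omega>) sequentially"
    using as_convergence by eventually_elim (rule path4_limitin_uniform)
  have lim_at: "AE \<omega> in M'. (\<lambda>l. X' l t \<omega>) \<longlonglongrightarrow> X t \<omega>" if "t \<in> {0..T}" for t
    using lim by eventually_elim (rule tendsto_uniform_limitI[OF _ that])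
  \<comment> \<open>The integral on \<open>M'\<close> equals the one on \<open>M\<close> for
    \<open>XN (N l)\<close>, where the covariance estimates apply.\<close>
  have X'_incr: "(\<integral>\<^sup>+\<omega>. ennreal ((X' l t \<omega> - X' l s \<omega>)\<^sup>2) \<partial>M') \<le> ennreal (K * \<bar>t - s\<bar> powr (2 * H1))"
    if "s \<in> {0..T}" "t \<in> {0..T}" for l s t
    using equal_in_law_path4_nn_integral[OF versions[of l] that, of "\<lambda>x. ennreal ((snd x - fst x)\<^sup>2)"]
      moments(1)[OF H _ _ that] by (simp add: K_def borel_prod[symmetric])
  have X'_4: "(\<integral>\<^sup>+\<omega>. ennreal (X' l t \<omega> ^ 4) \<partial>M') \<le> ennreal C" if "t \<in> {0..T}" for l t
    using equal_in_law_path4_nn_integral[OF versions[of l] that that, of "\<lambda>x. ennreal (snd x ^ 4)"]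
      moments(2)[OF H _ _ that] by (simp add: C_def borel_prod[symmetric])
  have X_incr: "(\<integral>\<^sup>+\<omega>. ennreal ((X t \<omega> - X s \<omega>)\<^sup>2) \<partial>M') \<le> ennreal (K * \<bar>t - s\<bar> powr (2 * H1))"
    if st: "s \<in> {0..T}" "t \<in> {0..T}" for s t
  proof (rule nn_integral_limit_le[where f = "\<lambda>l \<omega>. (X' l t \<omega> - X' l s \<omega>)\<^sup>2"])
    show "AE \<omega> in M'. (\<lambda>l. (X' l t \<omega> - X' l s \<omega>)\<^sup>2) \<longlonglongrightarrow> (X t \<omega> - X s \<omega>)\<^sup>2"
      using lim_at[OF st(1)] lim_at[OF st(2)] by eventually_elim (intro tendsto_intros)
  qed (use st X'_incr in auto)
  have X_4: "(\<integral>\<^sup>+\<omega>. ennreal (X t \<omega> ^ 4) \<partial>M') \<le> ennreal C" if t: "t \<in> {0..T}" for t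
  proof (rule nn_integral_limit_le[where f = "\<lambda>l \<omega>. X' l t \<omega> ^ 4"])
    show "AE \<omega> in M'. (\<lambda>l. X' l t \<omega> ^ 4) \<longlonglongrightarrow> X t \<omega> ^ 4"
      using lim_at[OF t] by eventually_elim (intro tendsto_intros)
  qed (use t X'_4 in auto)
  show ?thesis
  \<comment> \<open>The constants for the difference of two processes with bounds \<open>K\<close>
    and \<open>C\<close>: 4 * K = 2 * (K + K) from \<open>square_add_le\<close>, and 16 * C = 8 * (C
    + C) from \<open>power4_add_le\<close>.\<close>
  proof (rule besov_norm_tendsto_0[where H = H1 and A = "4 * K" and C = "16 * C"])
    show "AE \<omega> in M'. uniform_limit {0..T} (\<lambda>l t. X' l t \<omega> - X t \<omega>) (\<lambda>_. 0) sequentially"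
      using lim by eventually_elim (simp add: uniform_limit_iff dist_real_def)
    show "continuous_on {0..T} (\<lambda>s. X' l s \<omega> - X s \<omega>)" if "\<omega> \<in> space M'" for l \<omega>
      using path4_measurable_continuous[OF X'_path that] path4_measurable_continuous[OF limit_measurable that]
      by (rule continuous_on_diff)
    show "(\<integral>\<^sup>+\<omega>. ennreal ((X' l t \<omega> - X t \<omega> - (X' l s \<omega> - X s \<omega>))\<^sup>2) \<partial>M')
        \<le> ennreal (4 * K * \<bar>t - s\<bar> powr (2 * H1))"
      if st: "s \<in> {0..T}" "t \<in> {0..T}" for l s t
    proof -
      note [measurable] = m[OF st(1)] m[OF st(2)]
      let ?k = "K * \<bar>t - s\<bar> powr (2 * H1)"
      have "(\<integral>\<^sup>+\<omega>. ennreal ((X' l t \<omega> - X t \<omega> - (X' l s \<omega> - X s \<omega>))\<^sup>2) \<partial>M')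
          \<le> (\<integral>\<^sup>+\<omega>. 2 * (ennreal ((X' l t \<omega> - X' l s \<omega>)\<^sup>2) + ennreal ((X t \<omega> - X s \<omega>)\<^sup>2)) \<partial>M')"
      proof (intro nn_integral_mono)
        fix \<omega>
        have "(X' l t \<omega> - X t \<omega> - (X' l s \<omega> - X s \<omega>))\<^sup>2
            = ((X' l t \<omega> - X' l s \<omega>) + (- (X t \<omega> - X s \<omega>)))\<^sup>2" by (simp add: algebra_simps)
        also have "\<dots> \<le> 2 * ((X' l t \<omega> - X' l s \<omega>)\<^sup>2 + (X t \<omega> - X s \<omega>)\<^sup>2)"
          using square_add_le[of "X' l t \<omega> - X' l s \<omega>" "- (X t \<omega> - X s \<omega>)"] by (simp only: power2_minus)
        finally have le: "(X' l t \<omega> - X t \<omega> - (X' l s \<omega> - X s \<omega>))\<^sup>2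
            \<le> 2 * ((X' l t \<omega> - X' l s \<omega>)\<^sup>2 + (X t \<omega> - X s \<omega>)\<^sup>2)" .
        show "ennreal ((X' l t \<omega> - X t \<omega> - (X' l s \<omega> - X s \<omega>))\<^sup>2)
            \<le> 2 * (ennreal ((X' l t \<omega> - X' l s \<omega>)\<^sup>2) + ennreal ((X t \<omega> - X s \<omega>)\<^sup>2))"
          by (subst ennreal_numeral_mult_sum2; intro zero_le_power2 ennreal_leI le)
      qed
      also have "\<dots> = 2 * ((\<integral>\<^sup>+\<omega>. ennreal ((X' l t \<omega> - X' l s \<omega>)\<^sup>2) \<partial>M')
          + (\<integral>\<^sup>+\<omega>. ennreal ((X t \<omega> - X s \<omega>)\<^sup>2) \<partial>M'))"
        by (simp add: nn_integral_cmult nn_integral_add)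
      also have "\<dots> \<le> 2 * (ennreal ?k + ennreal ?k)"
        by (intro mult_left_mono add_mono X'_incr X_incr st) simp
      also have "\<dots> = ennreal (2 * (?k + ?k))" using K by (intro ennreal_numeral_mult_sum2) auto
      finally show ?thesis by (simp add: mult.assoc)
    qed
    show "(\<integral>\<^sup>+\<omega>. ennreal ((X' l t \<omega> - X t \<omega>) ^ 4) \<partial>M') \<le> ennreal (16 * C)" if t: "t \<in> {0..T}" for l t
    proof -
      note [measurable] = m[OF t]
      have "(\<integral>\<^sup>+\<omega>. ennreal ((X' l t \<omega> - X t \<omega>) ^ 4) \<partial>M')
          \<le> (\<integral>\<^sup>+\<omega>. 8 * (ennreal (X' l t \<omega> ^ 4) + ennreal (X t \<omega> ^ 4)) \<partial>M')"
      proof (intro nn_integral_mono)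
        fix \<omega>
        have le: "(X' l t \<omega> - X t \<omega>) ^ 4 \<le> 8 * (X' l t \<omega> ^ 4 + X t \<omega> ^ 4)"
          using power4_add_le[of "X' l t \<omega>" "- X t \<omega>"] by simp
        show "ennreal ((X' l t \<omega> - X t \<omega>) ^ 4) \<le> 8 * (ennreal (X' l t \<omega> ^ 4) + ennreal (X t \<omega> ^ 4))"
          by (subst ennreal_numeral_mult_sum2; intro ennreal_leI le zero_le_even_power even_numeral)
      qed
      also have "\<dots> = 8 * ((\<integral>\<^sup>+\<omega>. ennreal (X' l t \<omega> ^ 4) \<partial>M') + (\<integral>\<^sup>+\<omega>. ennreal (X t \<omega> ^ 4) \<partial>M'))"
        by (simp add: nn_integral_cmult nn_integral_add)
      also have "\<dots> \<le> 8 * (ennreal C + ennreal C)"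
        by (intro mult_left_mono add_mono X'_4 X_4 t) simp
      also have "\<dots> = ennreal (8 * (C + C))" using C by (intro ennreal_numeral_mult_sum2) auto
      finally show ?thesis by simp
    qed
  qed (use K assms in auto)
qed

end
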